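(* Fix integers $k\leq n$. Suppose we can construct an NFA $M$ of size $s$ with $L(M)= L_k(n)$ in time $O(s)$. Then we can solve MIN-WT SIMPLE (s,t)-k-PATH on graphs with $n$ vertices and non-negative integer weights of size at most $W$ in time $O(s\cdot\log s\cdot n^2\cdot \log W)$. In case $M$ is a directed acyclic graph, we can solve MIN-WT SIMPLE (s,t)-k-PATH on graphs with $n$ vertices and integer weights in the range $[-W,W]$ in time $O(s\cdot n^2\cdot \log W)$.
   Context: For integers $k\leq n$, $L_k(n)\subseteq [n]^k$ is the set of words $w_1\cdots w_k\in[n]^k$ such that $w_1,\ldots,w_k$ are all distinct. An NFA $M=\langle Q,\Delta,q_0,F\rangle$ over alphabet $\Sigma$ is a directed graph with vertex set $Q$ (states), edge set $\Delta$ (transitions), each transition labeled by an element of $\Sigma$, a start state $q_0\in Q$ and a set $F\subseteq Q$ of accepting states; $L(M)$ is the set of words labeling some path from $q_0$ to a state in $F$. The size of $M$ is $|Q|+|\Delta|$, and $M$ is acyclic if it is acyclic as a directed graph. In a directed graph $G$, a $k$-path is a path $v_1\to\cdots\to v_k$ (with $k$ vertices); it is simple if its vertices are distinct; for vertices $s,t$, an $(s,t)$-$k$-path is a $k$-path with $v_1=s$ and $v_k=t$. The weight of a path is the sum of the weights of its edges. The problem MIN-WT SIMPLE (s,t)-k-PATH: given a directed graph $G=(V,E)$ with weight function $w:E\to\mathbb{R}$, vertices $s,t\in V$ and an integer $k$, determine whether there exists a simple $(s,t)$-$k$-path in $G$, and if so return one of minimal weight. *)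

theory Defs
  imports
    Complex_Main
    "HOL-Library.Log_Nat"
    "Graph_Theory.Pair_Digraph"
    "Graph_Theory.Vertex_Walk"
begin

section \<open>Words with distinct letters and nondeterministic automata\<close>

definition distinct_words :: "nat \<Rightarrow> nat \<Rightarrow> nat list set" where
  "distinct_words k n = {x. length x = k \<and> set x \<subseteq> {1..n} \<and> distinct x}"

text \<open>
  Parallel transitions with different labels are different edges, so the
  edge set consists of triples (source, label, target).
\<close>

record ('q, 'a) nfa =
  states :: "'q set"
  transitions :: "('q \<times> 'a \<times> 'q) set"
  start :: 'q
  accepting :: "'q set"

definition nfa_over :: "'a set \<Rightarrow> ('q, 'a) nfa \<Rightarrow> bool" where
  "nfa_over A M \<longleftrightarrow>
     finite (states M) \<and> finite (transitions M) \<and>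
     transitions M \<subseteq> states M \<times> A \<times> states M \<and>
     start M \<in> states M \<and> accepting M \<subseteq> states M"

fun labels_path :: "('q \<times> 'a \<times> 'q) set \<Rightarrow> 'q \<Rightarrow> 'a list \<Rightarrow> 'q \<Rightarrow> bool" where
  "labels_path D p [] q \<longleftrightarrow> p = q"
| "labels_path D p (a # x) q \<longleftrightarrow> (\<exists>r. (p, a, r) \<in> D \<and> labels_path D r x q)"

definition nfa_lang :: "('q, 'a) nfa \<Rightarrow> 'a list set" where
  "nfa_lang M = {x. \<exists>q \<in> accepting M. labels_path (transitions M) (start M) x q}"

definition nfa_size :: "('q, 'a) nfa \<Rightarrow> nat" where
  "nfa_size M = card (states M) + card (transitions M)"

definition acyclic_nfa :: "('q, 'a) nfa \<Rightarrow> bool" where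
  "acyclic_nfa M \<longleftrightarrow> acyclic {(p, q). \<exists>a. (p, a, q) \<in> transitions M}"


section \<open>Minimum weight simple (s,t)-k-paths\<close>

definition simple_st_k_path :: "'v pair_pre_digraph \<Rightarrow> 'v \<Rightarrow> 'v \<Rightarrow> nat \<Rightarrow> 'v list \<Rightarrow> bool" where
  "simple_st_k_path G s t k p \<longleftrightarrow>
     vpath p (with_proj G) \<and> length p = k \<and> hd p = s \<and> last p = t"

definition path_weight :: "('v \<times> 'v \<Rightarrow> real) \<Rightarrow> 'v list \<Rightarrow> real" where
  "path_weight w p = sum_list (map w (vwalk_arcs p))"

definition min_wt_simple_st_k_path ::
  "'v pair_pre_digraph \<Rightarrow> ('v \<times> 'v \<Rightarrow> real) \<Rightarrow> 'v \<Rightarrow> 'v \<Rightarrow> nat \<Rightarrow> 'v list \<Rightarrow> bool" where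
  "min_wt_simple_st_k_path G w s t k p \<longleftrightarrow>
     simple_st_k_path G s t k p \<and>
     (\<forall>p'. simple_st_k_path G s t k p' \<longrightarrow> path_weight w p \<le> path_weight w p')"


section \<open>The machine model: a random access machine with words of \<open>b\<close> bits\<close>

text \<open>
  A program works on finitely many named integer arrays; a scalar is an array
  of which only cell 0 is used.  An integer that does not fit into one word
  occupies several words, and every operation is charged for the words of its
  operands: linearly for addition, subtraction, comparison and moving data,
  and with the schoolbook product for multiplication and division.
\<close>

type_synonym vname = string
type_synonym memory = "vname \<Rightarrow> int \<Rightarrow> int"

datatype binop = Add | Sub | Mul | Div | Mod | Lt | Eq

datatype aexp = Const int | Read vname aexp | Bin binop aexp aexp

datatype com =
    Skip
  | Assign vname aexp aexp  \<comment> \<open>array, index, new value\<close>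
  | Seq com com
  | If aexp com com
  | While aexp com

text \<open>The width of the two's complement representation, which includes a sign
  bit, divided by \<open>b\<close> and rounded up.\<close>

definition words :: "nat \<Rightarrow> int \<Rightarrow> nat" where
  "words b x = 1 + nat (bitlen \<bar>x\<bar>) div b"

fun binop_val :: "binop \<Rightarrow> int \<Rightarrow> int \<Rightarrow> int" where
  "binop_val Add x y = x + y"
| "binop_val Sub x y = x - y"
| "binop_val Mul x y = x * y"
| "binop_val Div x y = x div y"
| "binop_val Mod x y = x mod y"
| "binop_val Lt x y = (if x < y then 1 else 0)"
| "binop_val Eq x y = (if x = y then 1 else 0)"

fun binop_cost :: "nat \<Rightarrow> binop \<Rightarrow> int \<Rightarrow> int \<Rightarrow> nat" where
  "binop_cost b f x y =
     (if f \<in> {Mul, Div, Mod} then words b x * words b y else words b x + words b y)"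

fun aval :: "aexp \<Rightarrow> memory \<Rightarrow> int" where
  "aval (Const c) m = c"
| "aval (Read x i) m = m x (aval i m)"
| "aval (Bin f e1 e2) m = binop_val f (aval e1 m) (aval e2 m)"

fun acost :: "nat \<Rightarrow> aexp \<Rightarrow> memory \<Rightarrow> nat" where
  "acost b (Const c) m = words b c"
| "acost b (Read x i) m = acost b i m + words b (aval i m) + words b (m x (aval i m))"
| "acost b (Bin f e1 e2) m =
     acost b e1 m + acost b e2 m + binop_cost b f (aval e1 m) (aval e2 m)"

text \<open>\<open>exec b c m T m'\<close>: on words of \<open>b\<close> bits and started in memory
  \<open>m\<close>, the program \<open>c\<close> halts in memory \<open>m'\<close> after time \<open>T\<close>.\<close>

inductive exec :: "nat \<Rightarrow> com \<Rightarrow> memory \<Rightarrow> nat \<Rightarrow> memory \<Rightarrow> bool" for b :: nat where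
  Skip: "exec b Skip m 1 m"
| Assign: "exec b (Assign x i e) m
     (acost b i m + acost b e m + words b (aval i m) + words b (aval e m))
     (m(x := (m x)(aval i m := aval e m)))"
| Seq: "exec b c1 m T1 m1 \<Longrightarrow> exec b c2 m1 T2 m2 \<Longrightarrow> exec b (Seq c1 c2) m (T1 + T2) m2"
| IfTrue: "aval e m \<noteq> 0 \<Longrightarrow> exec b c1 m T m' \<Longrightarrow>
     exec b (If e c1 c2) m (acost b e m + T) m'"
| IfFalse: "aval e m = 0 \<Longrightarrow> exec b c2 m T m' \<Longrightarrow>
     exec b (If e c1 c2) m (acost b e m + T) m'"
| WhileFalse: "aval e m = 0 \<Longrightarrow> exec b (While e c) m (acost b e m) m"
| WhileTrue: "aval e m \<noteq> 0 \<Longrightarrow> exec b c m T1 m1 \<Longrightarrow> exec b (While e c) m1 T2 m2 \<Longrightarrow>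
     exec b (While e c) m (acost b e m + T1 + T2) m2"

lemma exec_deterministic:
  "exec b c m T m' \<Longrightarrow> exec b c m T' m'' \<Longrightarrow> T' = T \<and> m'' = m'"
proof (induction arbitrary: T' m'' rule: exec.induct)
  case (Seq c1 m T1 m1 c2 T2 m2)
  from Seq.prems show ?case by cases (use Seq.IH in blast)
next
  case (IfTrue e m c1 T m' c2)
  from IfTrue.prems show ?case by cases (use IfTrue.hyps IfTrue.IH in blast)+
next
  case (IfFalse e m c2 T m' c1)
  from IfFalse.prems show ?case by cases (use IfFalse.hyps IfFalse.IH in blast)+
next
  case (WhileTrue e m c T1 m1 T2 m2)
  from WhileTrue.prems show ?case by cases (use WhileTrue.hyps WhileTrue.IH in blast)+
next
  case (WhileFalse e m c)
  from WhileFalse.prems show ?case by cases (use WhileFalse.hyps in blast)+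
next
  case (Skip m)
  then show ?case by cases simp
next
  case (Assign x i e m)
  then show ?case by cases simp
qed

section \<open>Encoding of inputs and outputs\<close>

definition scalar :: "int \<Rightarrow> int \<Rightarrow> int" where
  "scalar c = (\<lambda>i. if i = 0 then c else 0)"

definition nfa_input :: "nat \<Rightarrow> nat \<Rightarrow> memory" where
  "nfa_input k n = (\<lambda>_ _. 0)(''k'' := scalar (int k), ''n'' := scalar (int n))"

text \<open>The states are numbered from 0, and every transition is listed once.\<close>

definition holds_nfa :: "memory \<Rightarrow> (nat, nat) nfa \<Rightarrow> bool" where
  "holds_nfa m M \<longleftrightarrow>
     states M = {..<card (states M)} \<and>
     m ''num_states'' 0 = int (card (states M)) \<and>
     m ''start'' 0 = int (start M) \<and>
     (\<forall>q \<in> states M. m ''accepting'' (int q) = (if q \<in> accepting M then 1 else 0)) \<and>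
     (\<exists>ts. distinct ts \<and> set ts = transitions M \<and>
        m ''num_transitions'' 0 = int (length ts) \<and>
        (\<forall>i < length ts. case ts ! i of (p, a, q) \<Rightarrow>
           m ''source'' (int i) = int p \<and>
           m ''label'' (int i) = int a \<and>
           m ''target'' (int i) = int q))"

definition constructs_nfa ::
  "nat \<Rightarrow> com \<Rightarrow> nat \<Rightarrow> nat \<Rightarrow> (nat, nat) nfa \<Rightarrow> real \<Rightarrow> bool" where
  "constructs_nfa b P k n M bound \<longleftrightarrow>
     (\<exists>T m. exec b P (nfa_input k n) T m \<and> holds_nfa m M \<and> real T \<le> bound)"

text \<open>The adjacency matrix and the weight matrix of a graph with vertices
  \<open>1, ..., n\<close>, row by row; the weight matrix is 0 outside the arcs.\<close>

definition matrix :: "nat \<Rightarrow> (nat \<times> nat \<Rightarrow> int) \<Rightarrow> int \<Rightarrow> int" where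
  "matrix n f = (\<lambda>i. if 0 \<le> i \<and> i < int (n * n)
     then f (nat i div n + 1, nat i mod n + 1) else 0)"

definition path_input ::
  "nat \<Rightarrow> nat \<Rightarrow> nat pair_pre_digraph \<Rightarrow> (nat \<times> nat \<Rightarrow> int) \<Rightarrow> nat \<Rightarrow> nat \<Rightarrow> memory" where
  "path_input k n G w s t = (\<lambda>_ _. 0)(
     ''k'' := scalar (int k),
     ''n'' := scalar (int n),
     ''s'' := scalar (int s),
     ''t'' := scalar (int t),
     ''adjacency'' := matrix n (\<lambda>e. if e \<in> parcs G then 1 else 0),
     ''weight'' := matrix n (\<lambda>e. if e \<in> parcs G then w e else 0))"

definition correct_path_output ::
  "nat pair_pre_digraph \<Rightarrow> (nat \<times> nat \<Rightarrow> real) \<Rightarrow> nat \<Rightarrow> nat \<Rightarrow> nat \<Rightarrow> memory \<Rightarrow> bool" where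
  "correct_path_output G w s t k m \<longleftrightarrow>
     (if \<exists>p. simple_st_k_path G s t k p
      then m ''found'' 0 = 1 \<and>
        (\<exists>p. min_wt_simple_st_k_path G w s t k p \<and>
           (\<forall>i < k. m ''path'' (int i) = int (p ! i)))
      else m ''found'' 0 = 0)"

text \<open>The program \<open>Q\<close> solves the problem on all graphs with \<open>n\<close> vertices and
  arc weights in \<open>R\<close>.\<close>

definition solves_min_wt_path ::
  "nat \<Rightarrow> com \<Rightarrow> nat \<Rightarrow> nat \<Rightarrow> int set \<Rightarrow> real \<Rightarrow> bool" where
  "solves_min_wt_path b Q k n R bound \<longleftrightarrow>
     (\<forall>G w s t.
        pair_wf_digraph G \<and> pverts G = {1..n} \<and> s \<in> {1..n} \<and> t \<in> {1..n} \<and>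
        (\<forall>e \<in> parcs G. w e \<in> R) \<longrightarrow>
        (\<exists>T m. exec b Q (path_input k n G w s t) T m \<and>
           correct_path_output G (\<lambda>e. real_of_int (w e)) s t k m \<and>
           real T \<le> bound))"

text \<open>
  \<open>M\<close> is an automaton for \<open>distinct_words k n\<close> that \<open>P\<close> constructs within time
  \<open>C\<close> times its size.  As usual for word machines, a word can hold the
  addresses of the automaton; for \<open>k \<ge> 1\<close> the size is at least \<open>n\<close>, so a word
  can hold a vertex as well.
\<close>

definition fast_distinct_words_nfa ::
  "real \<Rightarrow> com \<Rightarrow> nat \<Rightarrow> nat \<Rightarrow> nat \<Rightarrow> (nat, nat) nfa \<Rightarrow> bool" where
  "fast_distinct_words_nfa C P b k n M \<longleftrightarrow>
     nfa_over {1..n} M \<and> nfa_lang M = distinct_words k n \<and>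
     nfa_size M \<le> 2 ^ b \<and>
     constructs_nfa b P k n M (C * real (nfa_size M))"

end

theory Submission
  imports Defs
begin

text \<open>
  Since every word of \<open>L(M)\<close> has length \<open>k\<close>, the product of \<open>M\<close> and \<open>G\<close> can be searched in \<open>k\<close>
  layers: the weight \<open>d(j, q, v)\<close> of an optimal completion with \<open>j\<close> letters, read by \<open>M\<close> from
  state \<open>q\<close> and followed by \<open>G\<close> from vertex \<open>v\<close>, is the minimum of \<open>w(v, a) + d(j - 1, q', a)\<close>
  over the transitions \<open>(q, a, q')\<close> with an arc \<open>(v, a)\<close>.  This takes \<open>k |\<Delta>| (n + 1) = O(s n\<^sup>2)\<close>
  steps, each on numbers of \<open>O(log W)\<close> words, and the layers make it indifferent to cycles of \<open>M\<close>
  and to negative weights.  So one program serves both halves of the theorem, without the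
  factor \<open>log s\<close> of Dijkstra's algorithm.
\<close>

section \<open>Renaming arrays and bounding running times\<close>

text \<open>Acceptance by \<open>M\<close> already enforces length, alphabet and distinctness, so
  the search never records visited vertices; it only has to follow arcs of \<open>G\<close> and end
  in \<open>t\<close>. \<open>M\<close> reads all \<open>k\<close> vertices, whereas a
  \<open>k\<close>-path has only \<open>k - 1\<close> arcs. A virtual vertex 0 with an arc of weight
  0 to \<open>s\<close> supplies the missing arc, and this is why vertices take \<open>n + 1\<close>
  values. The cost model shapes the rest: operations are charged by word length, products by the
  product of the lengths. Addresses and step numbers are at most \<open>S ^ 3\<close> for the size
  \<open>S\<close> of \<open>M\<close>; as \<open>S \<le> 2 ^ b\<close>, they occupy at most five
  words. Only path weights are longer, and they are merely added, compared and moved. Hence the time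
  is the number of operations times a word bound linear in the bit length of
  \<open>W\<close>.\<close>

fun rename_aexp :: "(vname \<Rightarrow> vname) \<Rightarrow> aexp \<Rightarrow> aexp" where
  "rename_aexp f (Const c) = Const c"
| "rename_aexp f (Read x i) = Read (f x) (rename_aexp f i)"
| "rename_aexp f (Bin g e1 e2) = Bin g (rename_aexp f e1) (rename_aexp f e2)"

fun rename_com :: "(vname \<Rightarrow> vname) \<Rightarrow> com \<Rightarrow> com" where
  "rename_com f Skip = Skip"
| "rename_com f (Assign x i e) = Assign (f x) (rename_aexp f i) (rename_aexp f e)"
| "rename_com f (Seq c1 c2) = Seq (rename_com f c1) (rename_com f c2)"
| "rename_com f (If e c1 c2) = If (rename_aexp f e) (rename_com f c1) (rename_com f c2)"
| "rename_com f (While e c) = While (rename_aexp f e) (rename_com f c)"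

lemma aval_rename_aexp: "aval (rename_aexp f e) m = aval e (m \<circ> f)"
  by (induction e) auto

lemma acost_rename_aexp: "acost b (rename_aexp f e) m = acost b e (m \<circ> f)"
  by (induction e) (auto simp: aval_rename_aexp comp_def)

text \<open>A simulation: \<open>M \<circ> f\<close> is the memory that the original program sees.
  Injectivity keeps distinct arrays distinct, so all values and costs agree and the time
  \<open>T\<close> is unchanged. The last conjunct lets data outside the range of \<open>f\<close>
  survive the run.\<close>

lemma exec_rename_com:
  assumes "exec b c m T m'" and "inj f" and "M \<circ> f = m"
  shows "\<exists>M'. exec b (rename_com f c) M T M' \<and> M' \<circ> f = m' \<and> (\<forall>y. y \<notin> range f \<longrightarrow> M' y = M y)"
  using assms(1,3)
proof (induction arbitrary: M rule: exec.induct)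
  case (Skip m)
  then show ?case using exec.Skip[of b M] by auto
next
  case (Assign x i e m)
  let ?M = "M(f x := (M (f x))(aval i m := aval e m))"
  have "exec b (rename_com f (Assign x i e)) M
      (acost b i m + acost b e m + words b (aval i m) + words b (aval e m)) ?M"
    using exec.Assign[of b "f x" "rename_aexp f i" "rename_aexp f e" M] Assign
    by (simp add: aval_rename_aexp acost_rename_aexp)
  moreover have "?M \<circ> f = m(x := (m x)(aval i m := aval e m))"
    using Assign \<open>inj f\<close> by (auto simp: fun_eq_iff inj_eq)
  ultimately show ?case by (intro exI[of _ ?M] conjI) (assumption | auto)+
next
  case (Seq c1 m T1 m1 c2 T2 m2)
  obtain M1 where M1: "exec b (rename_com f c1) M T1 M1" "M1 \<circ> f = m1"
    "\<forall>y. y \<notin> range f \<longrightarrow> M1 y = M y" using Seq by blast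
  obtain M2 where M2: "exec b (rename_com f c2) M1 T2 M2" "M2 \<circ> f = m2"
    "\<forall>y. y \<notin> range f \<longrightarrow> M2 y = M1 y" using Seq M1 by blast
  show ?case using M1 M2 by (auto intro!: exI[of _ M2] exec.Seq)
next
  case (IfTrue e m c1 T m' c2)
  obtain M1 where M1: "exec b (rename_com f c1) M T M1" "M1 \<circ> f = m'"
    "\<forall>y. y \<notin> range f \<longrightarrow> M1 y = M y" using IfTrue by blast
  have "exec b (rename_com f (com.If e c1 c2)) M (acost b e m + T) M1"
    using exec.IfTrue[of "rename_aexp f e" M b "rename_com f c1" T M1] M1 IfTrue
    by (simp add: aval_rename_aexp acost_rename_aexp)
  then show ?case using M1 by blast
next
  case (IfFalse e m c2 T m' c1)
  obtain M1 where M1: "exec b (rename_com f c2) M T M1" "M1 \<circ> f = m'"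
    "\<forall>y. y \<notin> range f \<longrightarrow> M1 y = M y" using IfFalse by blast
  have "exec b (rename_com f (com.If e c1 c2)) M (acost b e m + T) M1"
    using exec.IfFalse[of "rename_aexp f e" M b "rename_com f c2" T M1] M1 IfFalse
    by (simp add: aval_rename_aexp acost_rename_aexp)
  then show ?case using M1 by blast
next
  case (WhileFalse e m c)
  have "exec b (rename_com f (While e c)) M (acost b e m) M"
    using exec.WhileFalse[of "rename_aexp f e" M b "rename_com f c"] WhileFalse
    by (simp add: aval_rename_aexp acost_rename_aexp)
  then show ?case using WhileFalse by blast
next
  case (WhileTrue e m c T1 m1 T2 m2)
  obtain M1 where M1: "exec b (rename_com f c) M T1 M1" "M1 \<circ> f = m1"
    "\<forall>y. y \<notin> range f \<longrightarrow> M1 y = M y" using WhileTrue by blast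
  obtain M2 where M2: "exec b (rename_com f (While e c)) M1 T2 M2" "M2 \<circ> f = m2"
    "\<forall>y. y \<notin> range f \<longrightarrow> M2 y = M1 y" using WhileTrue M1 by blast
  have "exec b (rename_com f (While e c)) M (acost b e m + T1 + T2) M2"
    using exec.WhileTrue[of "rename_aexp f e" M b "rename_com f c" T1 M1 T2 M2] M1 M2 WhileTrue
    by (simp add: aval_rename_aexp acost_rename_aexp)
  then show ?case using M1 M2 by (intro exI[of _ M2]) simp
qed

text \<open>\<open>fits A B e m\<close>: all intermediate results are at most \<open>B\<close> in absolute value and
  the operands of products and quotients are at most \<open>A\<close>, so that with \<open>A\<close> of constantly many
  words the schoolbook product does not make the cost quadratic in the words of \<open>B\<close>.\<close>

fun fits :: "int \<Rightarrow> int \<Rightarrow> aexp \<Rightarrow> memory \<Rightarrow> bool" where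
  "fits A B (Const c) m \<longleftrightarrow> \<bar>c\<bar> \<le> B"
| "fits A B (Read x i) m \<longleftrightarrow> fits A B i m \<and> \<bar>m x (aval i m)\<bar> \<le> B"
| "fits A B (Bin f e1 e2) m \<longleftrightarrow> fits A B e1 m \<and> fits A B e2 m \<and>
     \<bar>binop_val f (aval e1 m) (aval e2 m)\<bar> \<le> B \<and>
     (f \<in> {Mul, Div, Mod} \<longrightarrow> \<bar>aval e1 m\<bar> \<le> A \<and> \<bar>aval e2 m\<bar> \<le> A)"

text \<open>The constant 25 is the cost 5 * 5 of a product of operands of five words each; it also
  covers the two operands of a linear operation.\<close>

fun esize :: "aexp \<Rightarrow> nat" where
  "esize (Const c) = 1"
| "esize (Read x i) = esize i + 2"
| "esize (Bin f e1 e2) = esize e1 + esize e2 + 25"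

text \<open>For \<open>While\<close> this is a single pass of guard and body; repetition enters only
  through \<open>runs_While\<close>.\<close>

fun csize :: "com \<Rightarrow> nat" where
  "csize Skip = 1"
| "csize (Assign x i e) = esize i + esize e + 2"
| "csize (Seq c1 c2) = csize c1 + csize c2"
| "csize (If e c1 c2) = esize e + (csize c1 + csize c2)"
| "csize (While e c) = esize e + csize c"

text \<open>\<open>A\<close> is meant for addresses and counters, \<open>B\<close> for path weights.
  In bounds of the form \<open>K * N\<close>, the factor \<open>K\<close> accounts for word lengths
  and \<open>N\<close> for the number of operations.\<close>

locale word_bounds =
  fixes b K :: nat and A B :: int
  assumes words_A: "\<bar>x\<bar> \<le> A \<Longrightarrow> words b x \<le> 5"
    and words_B: "\<bar>x\<bar> \<le> B \<Longrightarrow> words b x \<le> K"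
    and K_pos: "1 \<le> K"
begin

lemma fits_aval: "fits A B e m \<Longrightarrow> \<bar>aval e m\<bar> \<le> B"
  by (cases e) auto

lemma acost_le: "fits A B e m \<Longrightarrow> acost b e m \<le> K * esize e"
proof (induction e)
  case (Const c)
  then show ?case using words_B by simp
next
  case (Read x i)
  then have "words b (aval i m) \<le> K" "words b (m x (aval i m)) \<le> K"
    using words_B fits_aval by auto
  with Read show ?case by (simp add: algebra_simps)
next
  case (Bin f e1 e2)
  have "binop_cost b f (aval e1 m) (aval e2 m) \<le> 25 * K"
  proof (cases "f \<in> {Mul, Div, Mod}")
    case True
    then have "words b (aval e1 m) \<le> 5" "words b (aval e2 m) \<le> 5"
      using Bin.prems by (auto intro: words_A)
    from mult_le_mono[OF this] show ?thesis using True K_pos by simp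
  next
    case False
    have "words b (aval e1 m) \<le> K" "words b (aval e2 m) \<le> K"
      using Bin.prems by (auto intro: words_B fits_aval)
    then show ?thesis using False by simp
  qed
  with Bin show ?case by (simp add: algebra_simps)
qed

section \<open>A total correctness calculus with running times in units of \<open>K\<close>\<close>

definition runs :: "com \<Rightarrow> nat \<Rightarrow> (memory \<Rightarrow> bool) \<Rightarrow> memory \<Rightarrow> bool" where
  "runs c N R m \<longleftrightarrow> (\<exists>T m'. exec b c m T m' \<and> T \<le> K * N \<and> R m')"

lemma runs_mono:
  "runs c N R m \<Longrightarrow> N \<le> N' \<Longrightarrow> (\<And>m'. R m' \<Longrightarrow> R' m') \<Longrightarrow> runs c N' R' m"
  unfolding runs_def by (meson le_trans mult_le_mono2)

lemma runs_Skip: "R m \<Longrightarrow> runs Skip (csize Skip) R m"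
  unfolding runs_def using K_pos exec.Skip[of b m] by auto

lemma runs_Assign:
  assumes "fits A B i m" "fits A B e m" "R (m(x := (m x)(aval i m := aval e m)))"
  shows "runs (Assign x i e) (csize (Assign x i e)) R m"
proof -
  have "words b (aval i m) \<le> K" "words b (aval e m) \<le> K"
    using assms fits_aval words_B by auto
  then have "acost b i m + acost b e m + words b (aval i m) + words b (aval e m)
      \<le> K * csize (Assign x i e)"
    using acost_le[OF assms(1)] acost_le[OF assms(2)] by (simp add: algebra_simps)
  then show ?thesis unfolding runs_def using exec.Assign assms(3) by blast
qed

lemma runs_Assign_val:
  assumes "fits A B i m" "fits A B e m" "aval i m = y" "aval e m = z" "R (m(x := (m x)(y := z)))"
  shows "runs (Assign x i e) (csize (Assign x i e)) R m"
  using runs_Assign assms by simp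

lemma runs_Seq:
  assumes "runs c1 N1 R1 m" "\<And>m1. R1 m1 \<Longrightarrow> runs c2 N2 R m1"
  shows "runs (Seq c1 c2) (N1 + N2) R m"
proof -
  obtain T1 m1 where 1: "exec b c1 m T1 m1" "T1 \<le> K * N1" "R1 m1"
    using assms(1) unfolding runs_def by blast
  obtain T2 m2 where 2: "exec b c2 m1 T2 m2" "T2 \<le> K * N2" "R m2"
    using assms(2)[OF 1(3)] unfolding runs_def by blast
  show ?thesis unfolding runs_def using exec.Seq[OF 1(1) 2(1)] 1(2) 2(2,3)
    by (intro exI[of _ "T1 + T2"] exI[of _ m2]) (simp add: algebra_simps)
qed

lemma runs_Seq_csize:
  assumes "runs c1 (csize c1) R1 m" "\<And>m1. R1 m1 \<Longrightarrow> runs c2 (csize c2) R m1"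
  shows "runs (Seq c1 c2) (csize (Seq c1 c2)) R m"
  using runs_Seq[OF assms] by simp

lemma runs_Assign_Seq:
  assumes "fits A B i m" "fits A B e m" "aval i m = y" "aval e m = z"
    "runs c (csize c) R (m(x := (m x)(y := z)))"
  shows "runs (Seq (Assign x i e) c) (csize (Seq (Assign x i e) c)) R m"
proof (rule runs_Seq_csize[OF runs_Assign[OF assms(1,2), where R = "\<lambda>m'. m' = m(x := (m x)(y := z))"]])
qed (use assms(3-) in auto)

lemma runs_If:
  assumes "fits A B e m"
    "aval e m \<noteq> 0 \<Longrightarrow> runs c1 N R m" "aval e m = 0 \<Longrightarrow> runs c2 N R m"
  shows "runs (If e c1 c2) (esize e + N) R m"
proof -
  obtain T m' where T: "exec b (if aval e m \<noteq> 0 then c1 else c2) m T m'" "T \<le> K * N" "R m'"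
    using assms(2,3) unfolding runs_def by (cases "aval e m = 0") auto
  then have "exec b (If e c1 c2) m (acost b e m + T) m'"
    by (auto intro: exec.IfTrue exec.IfFalse split: if_splits)
  moreover have "acost b e m + T \<le> K * (esize e + N)"
    using acost_le[OF assms(1)] T(2) by (simp add: algebra_simps)
  ultimately show ?thesis unfolding runs_def using T(3) by blast
qed

lemma runs_If_csize:
  assumes "fits A B e m"
    "aval e m \<noteq> 0 \<Longrightarrow> runs c1 (csize c1) R m" "aval e m = 0 \<Longrightarrow> runs c2 (csize c2) R m"
  shows "runs (If e c1 c2) (csize (If e c1 c2)) R m"
proof (rule runs_mono[OF runs_If[OF assms(1), of c1 "csize c1 + csize c2" R c2]])
  show "runs c1 (csize c1 + csize c2) R m" if "aval e m \<noteq> 0"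
    using runs_mono[OF assms(2)[OF that]] by simp
  show "runs c2 (csize c1 + csize c2) R m" if "aval e m = 0"
    using runs_mono[OF assms(3)[OF that]] by simp
qed auto

text \<open>The invariant is indexed by the number of completed passes, so it also determines how
  often the loop runs; the extra \<open>esize e\<close> pays for the final failing test.\<close>

lemma runs_While:
  assumes "\<And>i m. i < L \<Longrightarrow> I i m \<Longrightarrow> fits A B e m \<and> aval e m \<noteq> 0 \<and> runs c N (I (Suc i)) m"
    and "\<And>m. I L m \<Longrightarrow> fits A B e m \<and> aval e m = 0" and "I 0 m"
  shows "runs (While e c) (L * (esize e + N) + esize e) (I L) m"
proof -
  have "runs (While e c) ((L - i) * (esize e + N) + esize e) (I L) m"
    if "i \<le> L" "I i m" for i m
    using that
  \<comment> \<open>Induction on the passes left, because \<open>exec\<close> unrolls a loop from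
    its first pass.\<close>
  proof (induction "L - i" arbitrary: i m)
    case 0
    then have "i = L" by simp
    with 0 assms(2)[of m] have "exec b (While e c) m (acost b e m) m" "fits A B e m"
      by (auto intro: exec.WhileFalse)
    then show ?case unfolding runs_def using acost_le[of e m] 0 \<open>i = L\<close> by auto
  next
    case (Suc d)
    then have i: "i < L" by simp
    obtain T1 m1 where 1: "exec b c m T1 m1" "T1 \<le> K * N" "I (Suc i) m1"
      and e: "fits A B e m" "aval e m \<noteq> 0"
      using assms(1)[OF i Suc.prems(2)] unfolding runs_def by blast
    obtain T2 m2 where 2: "exec b (While e c) m1 T2 m2"
        "T2 \<le> K * ((L - Suc i) * (esize e + N) + esize e)" "I L m2"
      using Suc.hyps(1)[of "Suc i" m1] Suc.hyps(2) i 1(3) unfolding runs_def by fastforce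
    have "L - i = Suc (L - Suc i)" using i by simp
    then have "acost b e m + T1 + T2 \<le> K * ((L - i) * (esize e + N) + esize e)"
      using acost_le[OF e(1)] 1(2) 2(2) by (simp add: algebra_simps)
    then show ?case unfolding runs_def
      using exec.WhileTrue[OF e(2) 1(1) 2(1)] 2(3) by blast
  qed
  from this[of 0 m] show ?thesis using assms(3) by simp
qed

end

section \<open>The layered search\<close>

text \<open>The search without memory: transition \<open>e\<close> is the triple
  \<open>src e\<close>, \<open>lab e\<close>, \<open>tgt e\<close>. Labels start at 1, while
  vertices may also be 0, which is reserved for a source outside the graph.\<close>

locale layered_search =
  fixes n N :: nat and src lab tgt :: "nat \<Rightarrow> nat" and nt :: nat and acc :: "nat set"
    and t :: nat and arc :: "nat \<Rightarrow> nat \<Rightarrow> bool" and wt :: "nat \<Rightarrow> nat \<Rightarrow> int" and W :: int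
  assumes edge: "e < nt \<Longrightarrow> src e < N \<and> tgt e < N \<and> 1 \<le> lab e \<and> lab e \<le> n"
    and wt_le: "arc v a \<Longrightarrow> \<bar>wt v a\<bar> \<le> W"
begin

text \<open>The list omits the vertex of departure, so each letter is the head of the arc just
  taken. Departing from a vertex outside the graph, the list is the entire path.\<close>

fun walk :: "nat \<Rightarrow> nat list \<Rightarrow> bool" where
  "walk v [] \<longleftrightarrow> v = t"
| "walk v (a # x) \<longleftrightarrow> arc v a \<and> walk a x"

fun weight :: "nat \<Rightarrow> nat list \<Rightarrow> int" where
  "weight v [] = 0"
| "weight v (a # x) = wt v a + weight a x"

definition edges :: "(nat \<times> nat \<times> nat) set" where
  "edges = (\<lambda>e. (src e, lab e, tgt e)) ` {..<nt}"

definition completes :: "nat \<Rightarrow> nat \<Rightarrow> nat \<Rightarrow> nat list \<Rightarrow> bool" where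
  "completes j q v x \<longleftrightarrow> length x = j \<and> (\<exists>q' \<in> acc. labels_path edges q x q') \<and> walk v x"

text \<open>Step \<open>r\<close> of the search considers edge \<open>edge_of r\<close> after vertex \<open>vertex_of r\<close> for the
  completions of length \<open>layer_of r + 1\<close>.\<close>

definition vertex_of :: "nat \<Rightarrow> nat" where "vertex_of r = r mod (n + 1)"
definition edge_of :: "nat \<Rightarrow> nat" where "edge_of r = r div (n + 1) mod nt"
definition layer_of :: "nat \<Rightarrow> nat" where "layer_of r = r div (n + 1) div nt"

text \<open>The empty completion has no first transition, so in layer 0 a non-zero \<open>nx\<close>
  is a mere flag.\<close>

definition nil_layer :: "(nat \<times> nat \<times> nat \<Rightarrow> int) \<Rightarrow> (nat \<times> nat \<times> nat \<Rightarrow> int) \<Rightarrow> bool" where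
  "nil_layer nx bs \<longleftrightarrow> (\<forall>q<N. \<forall>v\<le>n. (nx (0, q, v) \<noteq> 0 \<longleftrightarrow> q \<in> acc \<and> v = t) \<and>
     0 \<le> nx (0, q, v) \<and> nx (0, q, v) \<le> 1 \<and> bs (0, q, v) = 0)"

text \<open>The loop invariant after \<open>r\<close> steps. Its second part is soundness: each
  entry is justified by an earlier step, with equality to the current entry one layer below. Its
  third part is optimality: no step already done could still improve the table. Both persist because
  steps are ordered by layer, so that no layer changes once the next one is being computed from
  it.\<close>

definition searched :: "nat \<Rightarrow> nat \<Rightarrow> (nat \<times> nat \<times> nat \<Rightarrow> int) \<Rightarrow> (nat \<times> nat \<times> nat \<Rightarrow> int) \<Rightarrow> bool" where
  "searched k r nx bs \<longleftrightarrow> nil_layer nx bs \<and>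
     (\<forall>j<k. \<forall>q<N. \<forall>v\<le>n. if nx (Suc j, q, v) = 0 then bs (Suc j, q, v) = 0 else
        \<exists>r'<r. layer_of r' = j \<and> vertex_of r' = v \<and> src (edge_of r') = q \<and>
          nx (Suc j, q, v) = int (edge_of r') + 1 \<and>
          arc v (lab (edge_of r')) \<and>
          nx (j, tgt (edge_of r'), lab (edge_of r')) \<noteq> 0 \<and>
          bs (Suc j, q, v) = wt v (lab (edge_of r')) + bs (j, tgt (edge_of r'), lab (edge_of r'))) \<and>
     (\<forall>r'<r. arc (vertex_of r') (lab (edge_of r')) \<longrightarrow>
        nx (layer_of r', tgt (edge_of r'), lab (edge_of r')) \<noteq> 0 \<longrightarrow>
        nx (Suc (layer_of r'), src (edge_of r'), vertex_of r') \<noteq> 0 \<and>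
        bs (Suc (layer_of r'), src (edge_of r'), vertex_of r') \<le>
          wt (vertex_of r') (lab (edge_of r')) + bs (layer_of r', tgt (edge_of r'), lab (edge_of r')))"

lemma vertex_of_le: "vertex_of r \<le> n"
  by (simp add: vertex_of_def mod_Suc_le_divisor)

lemma edge_of_less: "r < k * nt * (n + 1) \<Longrightarrow> edge_of r < nt"
  by (cases "nt = 0") (auto simp: edge_of_def)

lemma layer_of_less:
  assumes "r < k * nt * (n + 1)" shows "layer_of r < k"
  using assms unfolding layer_of_def
  by (simp add: less_mult_imp_div_less)

lemma layer_of_mono: "r' \<le> r \<Longrightarrow> layer_of r' \<le> layer_of r"
  unfolding layer_of_def by (intro div_le_mono)

lemma step_exists:
  assumes "j < k" "e < nt" "v \<le> n"
  obtains r where "r < k * nt * (n + 1)" "layer_of r = j" "edge_of r = e" "vertex_of r = v"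
proof
  \<comment> \<open>The mixed radix numeral with digits \<open>j\<close>, \<open>e\<close>,
    \<open>v\<close>, where \<open>e\<close> has radix \<open>nt\<close> and \<open>v\<close> has
    radix \<open>n + 1\<close>.\<close>
  let ?r = "(j * nt + e) * (n + 1) + v"
  have d: "?r div (n + 1) = j * nt + e" "?r mod (n + 1) = v"
    using assms by (simp_all only: div_mult_self3 mod_mult_self3) simp_all
  then show "layer_of ?r = j" "edge_of ?r = e" "vertex_of ?r = v"
    using assms by (simp_all only: layer_of_def edge_of_def vertex_of_def) simp_all
  have "j * nt + e + 1 \<le> (j + 1) * nt" using assms by simp
  also have "\<dots> \<le> k * nt" using assms by (intro mult_right_mono) auto
  finally have "(j * nt + e + 1) * (n + 1) \<le> k * nt * (n + 1)" by (rule mult_right_mono) simp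
  then show "?r < k * nt * (n + 1)" using assms(3) by (simp add: algebra_simps)
qed

lemma searched_start:
  assumes "nil_layer nx bs" "\<And>j q v. j < k \<Longrightarrow> q < N \<Longrightarrow> v \<le> n \<Longrightarrow> nx (Suc j, q, v) = 0 \<and> bs (Suc j, q, v) = 0"
  shows "searched k 0 nx bs"
  using assms by (auto simp: searched_def)

text \<open>An absent entry has the default weight 0 instead of infinity, so absence must be tested
  on \<open>nx\<close> before weights are compared.\<close>

definition improves :: "nat \<Rightarrow> (nat \<times> nat \<times> nat \<Rightarrow> int) \<Rightarrow> (nat \<times> nat \<times> nat \<Rightarrow> int) \<Rightarrow> bool" where
  "improves r nx bs \<longleftrightarrow>
     arc (vertex_of r) (lab (edge_of r)) \<and>
     nx (layer_of r, tgt (edge_of r), lab (edge_of r)) \<noteq> 0 \<and>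
     (nx (Suc (layer_of r), src (edge_of r), vertex_of r) = 0 \<or>
      wt (vertex_of r) (lab (edge_of r)) + bs (layer_of r, tgt (edge_of r), lab (edge_of r))
        < bs (Suc (layer_of r), src (edge_of r), vertex_of r))"

text \<open>The failed test is exactly what the optimality part demands of step \<open>r\<close>: if
  the step is applicable, its target entry exists and is no heavier.\<close>

lemma searched_keep:
  assumes "searched k r nx bs" "\<not> improves r nx bs"
  shows "searched k (Suc r) nx bs"
  unfolding searched_def
proof (intro conjI allI impI, goal_cases)
  case 1 then show ?case using assms by (simp add: searched_def)
next
  case (2 j q v)
  then have "if nx (Suc j, q, v) = 0 then bs (Suc j, q, v) = 0 else
        \<exists>r'<r. layer_of r' = j \<and> vertex_of r' = v \<and> src (edge_of r') = q \<and>
          nx (Suc j, q, v) = int (edge_of r') + 1 \<and>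
          arc v (lab (edge_of r')) \<and>
          nx (j, tgt (edge_of r'), lab (edge_of r')) \<noteq> 0 \<and>
          bs (Suc j, q, v) = wt v (lab (edge_of r')) + bs (j, tgt (edge_of r'), lab (edge_of r'))"
    using assms(1) unfolding searched_def by blast
  then show ?case by (auto intro: less_SucI split: if_splits)
next
  case (3 r')
  then show ?case using assms unfolding searched_def improves_def
    by (cases "r' = r") auto
next
  case (4 r')
  then show ?case using assms unfolding searched_def improves_def
    by (cases "r' = r") auto
qed

text \<open>The cell \<open>z\<close> lies in layer \<open>layer_of r + 1\<close>, while all steps
  up to \<open>r\<close> read layers at most \<open>layer_of r\<close>. So no justification of an
  entry reads the overwritten cell, and step \<open>r\<close> itself justifies the new
  value.\<close>

lemma searched_improve:
  assumes s: "searched k r nx bs" and r: "r < k * nt * (n + 1)" and i: "improves r nx bs"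
  defines "z \<equiv> (Suc (layer_of r), src (edge_of r), vertex_of r)"
  shows "searched k (Suc r) (nx(z := int (edge_of r) + 1))
    (bs(z := wt (vertex_of r) (lab (edge_of r)) + bs (layer_of r, tgt (edge_of r), lab (edge_of r))))"
    (is "searched k _ ?nx ?bs")
  unfolding searched_def
proof (intro conjI allI impI, goal_cases)
  case 1 then show ?case using s by (auto simp: searched_def nil_layer_def z_def)
next
  case (2 j q v)
  show ?case
  proof (cases "(Suc j, q, v) = z")
    case True
    then show ?thesis using i by (auto simp: z_def improves_def intro!: exI[of _ r])
  next
    case False
    show ?thesis
    proof (cases "nx (Suc j, q, v) = 0")
      case True
      then show ?thesis using False s 2 by (auto simp: searched_def)
    next
      case nz: False
      then obtain r' where r': "r' < r" "layer_of r' = j" "vertex_of r' = v" "src (edge_of r') = q"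
          "nx (Suc j, q, v) = int (edge_of r') + 1"
          "arc v (lab (edge_of r'))"
          "nx (j, tgt (edge_of r'), lab (edge_of r')) \<noteq> 0"
          "bs (Suc j, q, v) = wt v (lab (edge_of r')) + bs (j, tgt (edge_of r'), lab (edge_of r'))"
        using s 2 unfolding searched_def by (metis (no_types, lifting))
      have "(j, tgt (edge_of r'), lab (edge_of r')) \<noteq> z"
        using layer_of_mono[of r' r] r'(1,2) by (auto simp: z_def)
      with False nz r' show ?thesis by (auto intro!: exI[of _ r'])
    qed
  qed
next
  case (3 r')
  have l: "layer_of r' \<le> layer_of r" using 3 by (intro layer_of_mono) simp
  then show ?case using 3 s i unfolding searched_def improves_def z_def
    by (cases "r' = r") auto
next
  case (4 r')
  have l: "layer_of r' \<le> layer_of r" using 4 by (intro layer_of_mono) simp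
  then have z: "(layer_of r', tgt (edge_of r'), lab (edge_of r')) \<noteq> z" by (auto simp: z_def)
  show ?case
  proof (cases "r' = r")
    case True
    then show ?thesis using z by (simp add: z_def)
  next
    case False
    then have "r' < r" using 4 by simp
    then have "nx (Suc (layer_of r'), src (edge_of r'), vertex_of r') \<noteq> 0 \<and>
        bs (Suc (layer_of r'), src (edge_of r'), vertex_of r') \<le>
          wt (vertex_of r') (lab (edge_of r')) + bs (layer_of r', tgt (edge_of r'), lab (edge_of r'))"
      using s 4 z unfolding searched_def by auto
    \<comment> \<open>If the earlier step also targets \<open>z\<close>, its entry was non-zero, so
      \<open>improves\<close> yields a strict decrease and the old inequality remains true.\<close>
    then show ?thesis using z i by (auto simp: z_def improves_def)
  qed
qed

text \<open>Each layer adds one arc of weight at most \<open>W\<close>. The bound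
  \<open>nt + 1\<close> leaves room for the flag 1 of layer 0 even without transitions.\<close>

lemma searched_bounds:
  assumes "searched k r nx bs" "r \<le> k * nt * (n + 1)" "0 \<le> W"
  shows "j \<le> k \<Longrightarrow> q < N \<Longrightarrow> v \<le> n \<Longrightarrow>
    0 \<le> nx (j, q, v) \<and> nx (j, q, v) \<le> int nt + 1 \<and> \<bar>bs (j, q, v)\<bar> \<le> int j * W"
proof (induction j arbitrary: q v)
  case 0
  then have "0 \<le> nx (0, q, v) \<and> nx (0, q, v) \<le> 1 \<and> bs (0, q, v) = 0"
    using assms by (simp add: searched_def nil_layer_def)
  then show ?case by simp
next
  case (Suc j)
  show ?case
  proof (cases "nx (Suc j, q, v) = 0")
    case True
    then show ?thesis using Suc.prems assms by (auto simp: searched_def)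
  next
    case False
    then obtain r' where r': "r' < r" 
          "nx (Suc j, q, v) = int (edge_of r') + 1"
          "arc v (lab (edge_of r'))"
          "bs (Suc j, q, v) = wt v (lab (edge_of r')) + bs (j, tgt (edge_of r'), lab (edge_of r'))"
      using Suc.prems assms unfolding searched_def by (metis (no_types, lifting) Suc_le_eq)
    have e: "edge_of r' < nt" using r' assms edge_of_less[of r' k] by simp
    have "\<bar>bs (j, tgt (edge_of r'), lab (edge_of r'))\<bar> \<le> int j * W"
      using Suc edge[OF e] by auto
    then show ?thesis using r' e wt_le[OF r'(3)] by (auto simp: algebra_simps)
  qed
qed

text \<open>Follows the stored pointers; subtracting 1 undoes the shift that frees the value 0 to
  mean absence.\<close>

fun trace :: "(nat \<times> nat \<times> nat \<Rightarrow> int) \<Rightarrow> nat \<Rightarrow> nat \<Rightarrow> nat \<Rightarrow> nat list" where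
  "trace nx 0 q v = []"
| "trace nx (Suc j) q v = (let e = nat (nx (Suc j, q, v) - 1) in lab e # trace nx j (tgt e) (lab e))"

section \<open>Correctness of the completed table\<close>

context
  fixes k nx bs
  assumes finished: "searched k (k * nt * (n + 1)) nx bs"
begin

lemma searched_edge:
  assumes "j < k" "q < N" "v \<le> n" "nx (Suc j, q, v) \<noteq> 0"
  obtains e where "e < nt" "src e = q" "nx (Suc j, q, v) = int e + 1" "arc v (lab e)"
    "nx (j, tgt e, lab e) \<noteq> 0" "bs (Suc j, q, v) = wt v (lab e) + bs (j, tgt e, lab e)"
  using finished assms edge_of_less unfolding searched_def by metis

text \<open>Soundness: an entry of layer \<open>j + 1\<close> points to an entry of layer
  \<open>j\<close> and adds exactly one arc weight, so induction along the pointers recovers word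
  and weight.\<close>

lemma trace_completes:
  "j \<le> k \<Longrightarrow> q < N \<Longrightarrow> v \<le> n \<Longrightarrow> nx (j, q, v) \<noteq> 0 \<Longrightarrow>
    completes j q v (trace nx j q v) \<and> weight v (trace nx j q v) = bs (j, q, v)"
proof (induction j arbitrary: q v)
  case 0
  then show ?case using finished by (auto simp: completes_def searched_def nil_layer_def)
next
  case (Suc j)
  obtain e where e: "e < nt" "src e = q" "nx (Suc j, q, v) = int e + 1" "arc v (lab e)"
    "nx (j, tgt e, lab e) \<noteq> 0" "bs (Suc j, q, v) = wt v (lab e) + bs (j, tgt e, lab e)"
    using searched_edge[of j q v] Suc.prems by auto
  moreover have "completes j (tgt e) (lab e) (trace nx j (tgt e) (lab e)) \<and>
      weight (lab e) (trace nx j (tgt e) (lab e)) = bs (j, tgt e, lab e)"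
    using Suc e edge[OF e(1)] by auto
  moreover have "(q, lab e, tgt e) \<in> edges" using e by (auto simp: edges_def)
  ultimately show ?case by (auto simp: completes_def)
qed

text \<open>The first letter of \<open>x\<close> comes from a transition \<open>e\<close>; the step
  for \<open>j\<close>, \<open>e\<close>, \<open>v\<close> has been performed and can no longer
  improve anything, so the induction hypothesis for the tail lifts to \<open>x\<close>.\<close>

lemma searched_optimal:
  "j \<le> k \<Longrightarrow> q < N \<Longrightarrow> v \<le> n \<Longrightarrow> completes j q v x \<Longrightarrow>
    nx (j, q, v) \<noteq> 0 \<and> bs (j, q, v) \<le> weight v x"
proof (induction j arbitrary: q v x)
  case 0
  then show ?case using finished by (auto simp: completes_def searched_def nil_layer_def)
next
  case (Suc j)
  then obtain a y where x: "x = a # y" by (cases x) (auto simp: completes_def)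
  then obtain e where e: "e < nt" "src e = q" "lab e = a" and c: "completes j (tgt e) (lab e) y"
      and "arc v (lab e)"
    using Suc.prems by (auto simp: completes_def edges_def)
  moreover have "nx (j, tgt e, lab e) \<noteq> 0 \<and> bs (j, tgt e, lab e) \<le> weight (lab e) y"
    using Suc c edge[OF e(1)] by auto
  moreover obtain r where r: "r < k * nt * (n + 1)" "layer_of r = j" "edge_of r = e" "vertex_of r = v"
    using step_exists[of j k e v] Suc.prems e by auto
  moreover have "arc (vertex_of r) (lab (edge_of r)) \<longrightarrow>
      nx (layer_of r, tgt (edge_of r), lab (edge_of r)) \<noteq> 0 \<longrightarrow>
      nx (Suc (layer_of r), src (edge_of r), vertex_of r) \<noteq> 0 \<and>
      bs (Suc (layer_of r), src (edge_of r), vertex_of r) \<le>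
        wt (vertex_of r) (lab (edge_of r)) + bs (layer_of r, tgt (edge_of r), lab (edge_of r))"
    using finished r(1) unfolding searched_def by blast
  ultimately show ?case using x by auto
qed

end

end

section \<open>The search as a program\<close>

abbreviation scl :: "vname \<Rightarrow> aexp" where "scl x \<equiv> Read x (Const 0)"

text \<open>The prefix \<open>P\<close> marks the arrays of the renamed constructor of the automaton.  In the array
  \<open>next\<close> the value 0 means that there is no completion, and \<open>e + 1\<close> that an optimal one starts
  with transition \<open>e\<close>; so \<open>next\<close> and \<open>best\<close> need no initialisation.\<close>

definition table_cell :: "aexp \<Rightarrow> aexp \<Rightarrow> aexp \<Rightarrow> aexp" where
  "table_cell j q v = Bin Add (Bin Mul (Bin Add (Bin Mul j (scl ''Pnum_states'')) q)
     (Bin Add (scl ''n'') (Const 1))) v"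

definition nil_body :: com where
  "nil_body = Seq
     (If (Read ''Paccepting'' (scl ''i''))
        (Assign ''next'' (table_cell (Const 0) (scl ''i'') (scl ''t'')) (Const 1)) Skip)
     (Assign ''i'' (Const 0) (Bin Add (scl ''i'') (Const 1)))"

definition nil_com :: com where
  "nil_com = While (Bin Lt (scl ''i'') (scl ''Pnum_states'')) nil_body"

text \<open>Decoding one counter into its three digits replaces three nested loops, so that a single
  invariant indexed by \<open>r\<close> suffices.\<close>

definition locate_com :: com where
  "locate_com =
     Seq (Assign ''v'' (Const 0) (Bin Mod (scl ''r'') (Bin Add (scl ''n'') (Const 1))))
    (Seq (Assign ''e'' (Const 0) (Bin Mod (Bin Div (scl ''r'') (Bin Add (scl ''n'') (Const 1)))
            (scl ''Pnum_transitions'')))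
    (Seq (Assign ''j'' (Const 0) (Bin Div (Bin Div (scl ''r'') (Bin Add (scl ''n'') (Const 1)))
            (scl ''Pnum_transitions'')))
    (Seq (Assign ''a'' (Const 0) (Read ''Plabel'' (scl ''e'')))
    (Seq (Assign ''c'' (Const 0) (Bin Add (Bin Mul (Bin Sub (scl ''v'') (Const 1)) (scl ''n''))
            (Bin Sub (scl ''a'') (Const 1))))
    (Seq (Assign ''x'' (Const 0) (table_cell (scl ''j'') (Read ''Ptarget'' (scl ''e'')) (scl ''a'')))
         (Assign ''y'' (Const 0) (table_cell (Bin Add (scl ''j'') (Const 1))
            (Read ''Psource'' (scl ''e'')) (scl ''v''))))))))"

text \<open>The product serves as conjunction and the sum as disjunction. The factors are a 0/1 flag
  and a pointer, both at most \<open>A\<close>; weights occur only in sums and comparisons.\<close>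

definition relax_com :: com where
  "relax_com =
     If (Bin Mul (Read ''adjacency'' (scl ''c'')) (Read ''next'' (scl ''x'')))
       (Seq (Assign ''d'' (Const 0)
               (Bin Add (Read ''weight'' (scl ''c'')) (Read ''best'' (scl ''x''))))
            (If (Bin Add (Bin Eq (Read ''next'' (scl ''y'')) (Const 0))
                         (Bin Lt (scl ''d'') (Read ''best'' (scl ''y''))))
               (Seq (Assign ''next'' (scl ''y'') (Bin Add (scl ''e'') (Const 1)))
                    (Assign ''best'' (scl ''y'') (scl ''d'')))
               Skip))
       Skip"

definition search_body :: com where
  "search_body = Seq locate_com
     (Seq relax_com (Assign ''r'' (Const 0) (Bin Add (scl ''r'') (Const 1))))"

definition search_com :: com where
  "search_com = While (Bin Lt (scl ''r'')
     (Bin Mul (Bin Mul (scl ''k'') (scl ''Pnum_transitions'')) (Bin Add (scl ''n'') (Const 1))))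
     search_body"

definition extract_body :: com where
  "extract_body =
     Seq (Assign ''e'' (Const 0) (Bin Sub (Read ''next''
            (table_cell (Bin Sub (scl ''k'') (scl ''l'')) (scl ''q'') (scl ''v''))) (Const 1)))
    (Seq (Assign ''v'' (Const 0) (Read ''Plabel'' (scl ''e'')))
    (Seq (Assign ''path'' (scl ''l'') (scl ''v''))
    (Seq (Assign ''q'' (Const 0) (Read ''Ptarget'' (scl ''e'')))
         (Assign ''l'' (Const 0) (Bin Add (scl ''l'') (Const 1))))))"

definition extract_com :: com where
  "extract_com =
     Seq (Assign ''found'' (Const 0) (Bin Lt (Const 0)
            (Read ''next'' (table_cell (scl ''k'') (scl ''Pstart'') (Const 0)))))
    (Seq (Assign ''q'' (Const 0) (scl ''Pstart''))
    (Seq (Assign ''v'' (Const 0) (Const 0))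
         (If (scl ''found'') (While (Bin Lt (scl ''l'') (scl ''k'')) extract_body) Skip)))"

definition solve_com :: com where
  "solve_com = Seq nil_com (Seq search_com extract_com)"

text \<open>\<open>A\<close> dominates everything that is multiplied or divided: table addresses,
  step numbers, matrix addresses and shifted transition numbers. \<open>B\<close> dominates in
  addition the weight of \<open>k\<close> arcs.\<close>

locale search_program =
  layered_search n N src lab tgt nt acc t arc wt W + word_bounds b K A B
  for n N :: nat and src lab tgt :: "nat \<Rightarrow> nat" and nt :: nat and acc :: "nat set"
    and t :: nat and arc :: "nat \<Rightarrow> nat \<Rightarrow> bool" and wt :: "nat \<Rightarrow> nat \<Rightarrow> int" and W :: int
    and b K :: nat and A B :: int +
  fixes k start :: nat
  assumes start: "start < N" and t: "t \<le> n" and W: "0 \<le> W"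
    and A_table: "int ((k + 1) * N * (n + 1)) \<le> A"
    and A_steps: "int (k * nt * (n + 1)) \<le> A"
    and A_matrix: "int (n * n) \<le> A"
    and A_edge: "int nt + 1 \<le> A"
    and B_weight: "int k * W \<le> B"
    and A_le_B: "A \<le> B"
begin

text \<open>For \<open>v = 0\<close> the matrix addresses run from \<open>-n\<close> to
  \<open>-1\<close>, which is the row of the virtual vertex. Weights are prescribed on arcs
  only.\<close>

definition holds_input :: "memory \<Rightarrow> bool" where
  "holds_input m \<longleftrightarrow>
     m ''k'' 0 = int k \<and> m ''n'' 0 = int n \<and> m ''t'' 0 = int t \<and>
     m ''Pnum_states'' 0 = int N \<and> m ''Pnum_transitions'' 0 = int nt \<and> m ''Pstart'' 0 = int start \<and>
     (\<forall>q<N. m ''Paccepting'' (int q) = (if q \<in> acc then 1 else 0)) \<and>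
     (\<forall>e<nt. m ''Psource'' (int e) = int (src e) \<and> m ''Plabel'' (int e) = int (lab e) \<and>
        m ''Ptarget'' (int e) = int (tgt e)) \<and>
     (\<forall>v\<le>n. \<forall>a. 1 \<le> a \<longrightarrow> a \<le> n \<longrightarrow>
        m ''adjacency'' ((int v - 1) * int n + (int a - 1)) = (if arc v a then 1 else 0) \<and>
        (arc v a \<longrightarrow> m ''weight'' ((int v - 1) * int n + (int a - 1)) = wt v a))"

lemma holds_input_cong:
  assumes "\<And>x. x \<in> set [''k'', ''n'', ''t'', ''Pnum_states'', ''Pnum_transitions'', ''Pstart'',
    ''Paccepting'', ''Psource'', ''Plabel'', ''Ptarget'', ''adjacency'', ''weight''] \<Longrightarrow> m' x = m x"
  shows "holds_input m' = holds_input m"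
  unfolding holds_input_def by (simp add: assms)

lemma holds_input_upd:
  assumes "x \<notin> set [''k'', ''n'', ''t'', ''Pnum_states'', ''Pnum_transitions'', ''Pstart'',
    ''Paccepting'', ''Psource'', ''Plabel'', ''Ptarget'', ''adjacency'', ''weight'']"
  shows "holds_input (m(x := f)) = holds_input m"
proof (rule holds_input_cong)
  fix y assume "y \<in> set [''k'', ''n'', ''t'', ''Pnum_states'', ''Pnum_transitions'', ''Pstart'',
    ''Paccepting'', ''Psource'', ''Plabel'', ''Ptarget'', ''adjacency'', ''weight'']"
  with assms have "y \<noteq> x" by metis
  then show "(m(x := f)) y = m y" by (rule fun_upd_other)
qed

section \<open>The three-dimensional table in a linear array\<close>

definition index :: "nat \<times> nat \<times> nat \<Rightarrow> nat" where
  "index = (\<lambda>(j, q, v). (j * N + q) * (n + 1) + v)"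

definition cells :: "(nat \<times> nat \<times> nat) set" where
  "cells = {(j, q, v). q < N \<and> v \<le> n}"

text \<open>Since \<open>index\<close> is injective only on \<open>cells\<close>, cutting off
  elsewhere makes a memory write a function update at one point, as \<open>table_upd\<close>
  states.\<close>

definition table :: "memory \<Rightarrow> vname \<Rightarrow> nat \<times> nat \<times> nat \<Rightarrow> int" where
  "table m x z = (if z \<in> cells then m x (int (index z)) else 0)"

lemma mixed_radix_unique:
  fixes a a' d r r' :: nat
  assumes "r < d" "r' < d" "a * d + r = a' * d + r'"
  shows "a = a'" "r = r'"
proof -
  have "a = (a * d + r) div d" using assms(1) by simp
  also have "\<dots> = (a' * d + r') div d" by (simp only: assms(3))
  also have "\<dots> = a'" using assms(2) by simp
  finally show "a = a'" .
  then show "r = r'" using assms(3) by simp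
qed

lemma inj_on_index: "inj_on index cells"
proof (rule inj_onI)
  fix y z assume "y \<in> cells" "z \<in> cells" and eq: "index y = index z"
  then obtain j q v j' q' v' where y: "y = (j, q, v)" "q < N" "v < n + 1"
    and z: "z = (j', q', v')" "q' < N" "v' < n + 1"
    by (auto simp: cells_def less_Suc_eq_le)
  have "j * N + q = j' * N + q'" "v = v'"
    using mixed_radix_unique[of v "n + 1" v' "j * N + q" "j' * N + q'"] eq y z
    unfolding index_def by auto
  moreover have "j = j'" "q = q'" using mixed_radix_unique[of q N q' j j'] y z calculation by auto
  ultimately show "y = z" using y z by simp
qed

lemma table_upd_other: "x \<noteq> y \<Longrightarrow> table (m(x := f)) y = table m y"
  by (auto simp: table_def fun_eq_iff)

lemma table_upd:
  "z \<in> cells \<Longrightarrow> table (m(x := (m x)(int (index z) := c))) x = (table m x)(z := c)"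
  by (auto simp: table_def fun_eq_iff dest: inj_onD[OF inj_on_index])

lemma index_less:
  assumes "j \<le> k" "q < N" "v \<le> n"
  shows "index (j, q, v) < (k + 1) * N * (n + 1)"
proof -
  have "j * N \<le> k * N" using assms by simp
  then have "j * N + q + 1 \<le> (k + 1) * N" using assms(2) unfolding add_mult_distrib by linarith
  then have "(j * N + q + 1) * (n + 1) \<le> (k + 1) * N * (n + 1)" by (rule mult_right_mono) simp
  then show ?thesis using assms by (simp add: index_def)
qed

text \<open>All three factors of \<open>(k + 1) * N * (n + 1)\<close> are positive, as the start
  state gives \<open>1 \<le> N\<close>; so each of them is at most the product.\<close>

lemma A_bounds: "int k + 1 \<le> A" "int n + 1 \<le> A" "int N \<le> A" "1 \<le> A"
proof -
  define X where "X = (k + 1) * N * (n + 1)"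
  have N: "N \<ge> 1" using start by simp
  have "(k + 1) * 1 * 1 \<le> X" using N unfolding X_def by (intro mult_le_mono) auto
  moreover have "1 * 1 * (n + 1) \<le> X" using N unfolding X_def by (intro mult_le_mono) auto
  moreover have "1 * N * 1 \<le> X" unfolding X_def by (intro mult_le_mono) auto
  ultimately have "int (k + 1) \<le> int X" "int (n + 1) \<le> int X" "int N \<le> int X"
    by (simp_all only: of_nat_le_iff mult_1_left mult_1_right)
  moreover have "int X \<le> A" using A_table by (simp only: X_def)
  ultimately show "int k + 1 \<le> A" "int n + 1 \<le> A" "int N \<le> A" "1 \<le> A" by linarith+
qed

text \<open>The address is evaluated by Horner's scheme on non-negative numbers, so its partial
  results are at most the final address, which is at most \<open>A\<close>.\<close>

lemma table_cell:
  assumes "holds_input m" "fits A B ej m" "fits A B eq m" "fits A B ev m"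
    "aval ej m = int j" "aval eq m = int q" "aval ev m = int v" "j \<le> k" "q < N" "v \<le> n"
  shows "aval (table_cell ej eq ev) m = int (index (j, q, v))" "fits A B (table_cell ej eq ev) m"
proof -
  have m: "m ''Pnum_states'' 0 = int N" "m ''n'' 0 = int n" using assms(1) by (auto simp: holds_input_def)
  show "aval (table_cell ej eq ev) m = int (index (j, q, v))"
    using assms m by (simp add: table_cell_def index_def algebra_simps)
  have le: "int (index (j, q, v)) \<le> A" using index_less[of j q v] assms A_table by linarith
  define P Z where "P = int j * int N" and "Z = (P + int q) * (int n + 1)"
  have "0 \<le> P + int q" "0 \<le> P" by (simp_all add: P_def)
  then have 1: "(P + int q) * 1 \<le> Z" unfolding Z_def by (intro mult_left_mono) auto
  have "Z + int v = int (index (j, q, v))" by (simp add: index_def Z_def P_def algebra_simps)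
  then have 2: "Z + int v \<le> A" using le by simp
  have 3: "int j \<le> int k" "0 \<le> int q" "0 \<le> int v" using assms by simp_all
  have "\<bar>int j\<bar> \<le> A \<and> \<bar>int N\<bar> \<le> A \<and> \<bar>P\<bar> \<le> A \<and> \<bar>P + int q\<bar> \<le> A \<and> \<bar>int n\<bar> \<le> A \<and> \<bar>int n + 1\<bar> \<le> A \<and>
      \<bar>Z\<bar> \<le> A \<and> \<bar>Z + int v\<bar> \<le> A \<and> \<bar>0\<bar> \<le> A \<and> \<bar>1\<bar> \<le> A"
    using 1 2 3 \<open>0 \<le> P\<close> A_bounds by auto
  then show "fits A B (table_cell ej eq ev) m"
    unfolding table_cell_def fits.simps aval.simps binop_val.simps m assms(5-7) P_def[symmetric] Z_def[symmetric]
    using assms(2-4) A_le_B by auto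
qed

text \<open>\<open>r\<close> and \<open>l\<close> are carried along because the two later loops rely
  on their counters still being 0.\<close>

definition nil_inv :: "nat \<Rightarrow> memory \<Rightarrow> bool" where
  "nil_inv i m \<longleftrightarrow> holds_input m \<and> m ''i'' 0 = int i \<and> m ''r'' 0 = 0 \<and> m ''l'' 0 = 0 \<and>
     table m ''next'' = (\<lambda>(j, q, v). if j = 0 \<and> q < i \<and> q \<in> acc \<and> v = t then 1 else 0) \<and>
     table m ''best'' = (\<lambda>_. 0)"

lemma runs_nil_body:
  assumes "i < N" "nil_inv i m"
  shows "runs nil_body (csize nil_body) (nil_inv (Suc i)) m"
proof -
  have m: "holds_input m" "m ''i'' 0 = int i" using assms by (auto simp: nil_inv_def)
  then have m': "m ''t'' 0 = int t" "m ''Paccepting'' (int i) = (if i \<in> acc then 1 else 0)"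
    using assms(1) by (auto simp: holds_input_def)
  have B: "1 \<le> B" "0 \<le> B" "int i + 1 \<le> B" "int i \<le> B" "int t \<le> B"
    using A_bounds A_le_B assms(1) t by linarith+
  have c: "aval (table_cell (Const 0) (scl ''i'') (scl ''t'')) m = int (index (0, i, t))"
     "fits A B (table_cell (Const 0) (scl ''i'') (scl ''t'')) m"
    using table_cell[OF m(1), of "Const 0" "scl ''i''" "scl ''t''" 0 i t] m m' B assms(1) t
    by simp_all
  have z: "(0, i, t) \<in> cells" using assms(1) t by (simp add: cells_def)
  let ?R = "\<lambda>m. holds_input m \<and> m ''i'' 0 = int i \<and> m ''r'' 0 = 0 \<and> m ''l'' 0 = 0 \<and>
     table m ''next'' = (\<lambda>(j, q, v). if j = 0 \<and> q < Suc i \<and> q \<in> acc \<and> v = t then 1 else 0) \<and>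
     table m ''best'' = (\<lambda>_. 0)"
  show ?thesis unfolding nil_body_def
  proof (rule runs_Seq_csize[where ?R1.0 = ?R])
    show "runs (com.If (Read ''Paccepting'' (scl ''i'')) (Assign ''next'' (table_cell (Const 0) (scl ''i'') (scl ''t'')) (Const 1)) Skip)
      (csize (com.If (Read ''Paccepting'' (scl ''i'')) (Assign ''next'' (table_cell (Const 0) (scl ''i'') (scl ''t'')) (Const 1)) Skip)) ?R m"
    proof (rule runs_If_csize)
      show "fits A B (Read ''Paccepting'' (scl ''i'')) m" using m m' B by simp
      assume acc: "aval (Read ''Paccepting'' (scl ''i'')) m \<noteq> 0"
      show "runs (Assign ''next'' (table_cell (Const 0) (scl ''i'') (scl ''t'')) (Const 1))
        (csize (Assign ''next'' (table_cell (Const 0) (scl ''i'') (scl ''t'')) (Const 1))) ?R m"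
      proof (rule runs_Assign)
        show "?R (m(''next'' := (m ''next'')(aval (table_cell (Const 0) (scl ''i'') (scl ''t'')) m := aval (Const 1) m)))"
        proof -
          have "i \<in> acc" using acc m m' by (simp split: if_splits)
          then have "(table m ''next'')((0, i, t) := 1) =
              (\<lambda>(j, q, v). if j = 0 \<and> q < Suc i \<and> q \<in> acc \<and> v = t then 1 else 0)"
            using assms(2) by (auto simp: nil_inv_def fun_eq_iff less_Suc_eq)
          then show ?thesis using assms(2) unfolding c aval.simps nil_inv_def
            by (simp add: holds_input_upd table_upd[OF z] table_upd_other)
        qed
      qed (use c B in auto)
    next
      assume "aval (Read ''Paccepting'' (scl ''i'')) m = 0"
      then show "runs Skip (csize Skip) ?R m" using m m' assms(2)
        by (intro runs_Skip) (auto simp: nil_inv_def fun_eq_iff less_Suc_eq split: if_splits)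
    qed
    fix m1 assume "?R m1"
    then show "runs (Assign ''i'' (Const 0) (Bin Add (scl ''i'') (Const 1)))
       (csize (Assign ''i'' (Const 0) (Bin Add (scl ''i'') (Const 1)))) (nil_inv (Suc i)) m1"
      using B by (intro runs_Assign) (auto simp: nil_inv_def holds_input_upd table_upd_other)
  qed
qed

lemma runs_nil_com:
  assumes "nil_inv 0 m"
  shows "runs nil_com (300 * N + 300) (nil_inv N) m"
proof -
  let ?e = "Bin Lt (scl ''i'') (scl ''Pnum_states'')"
  have e: "fits A B ?e m \<and> aval ?e m = (if i < N then 1 else 0)" if "nil_inv i m" "i \<le> N" for i m
    using that A_bounds A_le_B by (auto simp: nil_inv_def holds_input_def)
  have "runs nil_com (N * (esize ?e + csize nil_body) + esize ?e) (nil_inv N) m"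
    unfolding nil_com_def
    using assms e by (intro runs_While[where I = nil_inv]) (simp_all add: runs_nil_body del: aval.simps fits.simps)
  then show ?thesis
    by (rule runs_mono) (simp_all add: nil_body_def table_cell_def)
qed

section \<open>One step of the search and the search loop\<close>

definition search_inv :: "nat \<Rightarrow> memory \<Rightarrow> bool" where
  "search_inv r m \<longleftrightarrow> holds_input m \<and> m ''r'' 0 = int r \<and> m ''l'' 0 = 0 \<and>
     searched k r (table m ''next'') (table m ''best'')"

definition located :: "nat \<Rightarrow> memory \<Rightarrow> bool" where
  "located r m \<longleftrightarrow> search_inv r m \<and> m ''e'' 0 = int (edge_of r) \<and>
     m ''c'' 0 = (int (vertex_of r) - 1) * int n + (int (lab (edge_of r)) - 1) \<and>
     m ''x'' 0 = int (index (layer_of r, tgt (edge_of r), lab (edge_of r))) \<and>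
     m ''y'' 0 = int (index (Suc (layer_of r), src (edge_of r), vertex_of r))"

text \<open>Row 0 has negative addresses, so both sides need a bound: \<open>-n\<close> from below
  and \<open>n * n\<close> from above.\<close>

lemma matrix_index:
  assumes "v \<le> n" "1 \<le> a" "a \<le> n"
  shows "\<bar>(int v - 1) * int n\<bar> \<le> A" "\<bar>(int v - 1) * int n + (int a - 1)\<bar> \<le> A"
proof -
  have "- int n \<le> (int v - 1) * int n"
    using mult_right_mono[of "-1" "int v - 1" "int n"] by simp
  moreover have "(int v - 1) * int n \<le> (int n - 1) * int n"
    using assms by (intro mult_right_mono) auto
  then have "(int v - 1) * int n + int n \<le> int (n * n)" by (simp add: algebra_simps)
  ultimately show "\<bar>(int v - 1) * int n\<bar> \<le> A" "\<bar>(int v - 1) * int n + (int a - 1)\<bar> \<le> A"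
    using A_matrix A_bounds assms by linarith+
qed

lemma runs_locate_com:
  assumes r: "r < k * nt * (n + 1)" and m: "search_inv r m"
  shows "runs locate_com (csize locate_com) (located r) m"
proof -
  let ?v = "vertex_of r" and ?e = "edge_of r" and ?j = "layer_of r"
  let ?q = "src ?e" and ?a = "lab ?e" and ?p = "tgt ?e"
  have h: "holds_input m" "m ''r'' 0 = int r" using m by (auto simp: search_inv_def)
  have e: "?e < nt" and j: "?j < k" and v: "?v \<le> n"
    using r edge_of_less layer_of_less vertex_of_le by blast+
  note ed = edge[OF e]
  have rA: "int r \<le> A" using r A_steps by linarith
  \<comment> \<open>\<open>u\<close> is the quotient \<open>r div (n + 1)\<close>, from which both
    the transition and the layer are split off.\<close>
  obtain u where u: "int r div (int n + 1) = int u" "int r mod (int n + 1) = int ?v"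
      "int u mod int nt = int ?e" "int u div int nt = int ?j" and dA: "int u \<le> A"
  proof
    have n1: "int (n + 1) = int n + 1" by simp
    show "int r div (int n + 1) = int (r div (n + 1))" "int r mod (int n + 1) = int ?v"
      unfolding n1[symmetric] vertex_of_def by (simp_all only: zdiv_int zmod_int)
    show "int (r div (n + 1)) mod int nt = int ?e" "int (r div (n + 1)) div int nt = int ?j"
      unfolding edge_of_def layer_of_def by (simp_all only: zdiv_int zmod_int)
    show "int (r div (n + 1)) \<le> A" using rA div_le_dividend[of r "n + 1"] by linarith
  qed
  have B: "0 \<le> B" "1 \<le> B" "int r \<le> B" "int u \<le> B" "int n \<le> B" "int n + 1 \<le> B" "int nt \<le> B"
    "int ?v \<le> B" "int ?e \<le> B" "int ?j + 1 \<le> B" "int ?j \<le> B" "int ?a \<le> B" "int ?p \<le> B" "int ?q \<le> B"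
    "\<bar>int ?v - 1\<bar> \<le> B" "\<bar>int ?v - 1\<bar> \<le> A" "\<bar>int ?a - 1\<bar> \<le> B"  "int n \<le> A" "int n + 1 \<le> A" "int nt \<le> A" "0 \<le> A"
    using rA dA A_bounds A_edge A_le_B e j v ed by linarith+
  note M = matrix_index[OF v, of ?a]
  have MB: "\<bar>(int ?v - 1) * int n\<bar> \<le> B" "\<bar>(int ?v - 1) * int n + (int ?a - 1)\<bar> \<le> B"
    using M ed A_le_B by linarith+
  have hi: "m ''n'' 0 = int n" "m ''Pnum_transitions'' 0 = int nt" "m ''Plabel'' (int ?e) = int ?a"
    "m ''Psource'' (int ?e) = int ?q" "m ''Ptarget'' (int ?e) = int ?p"
    using h e by (auto simp: holds_input_def)
  note simps = h hi u B rA dA M MB ed[simplified]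
  show ?thesis unfolding locate_com_def
    apply (rule runs_Assign_Seq[where y = 0 and z = "int ?v"]; (simp add: simps; fail)?)
    apply (rule runs_Assign_Seq[where y = 0 and z = "int ?e"]; (simp add: simps; fail)?)
    apply (rule runs_Assign_Seq[where y = 0 and z = "int ?j"]; (simp add: simps; fail)?)
    apply (rule runs_Assign_Seq[where y = 0 and z = "int ?a"]; (simp add: simps; fail)?)
    apply (rule runs_Assign_Seq[where y = 0 and z = "(int ?v - 1) * int n + (int ?a - 1)"]; (simp add: simps; fail)?)
    apply (rule runs_Assign_Seq[where y = 0 and z = "int (index (?j, ?p, ?a))"]; (simp add: simps; fail)?)
    subgoal by (rule table_cell(2)[where j = ?j and q = ?p and v = ?a]; simp add: simps holds_input_upd less_imp_le j v; fail)
    subgoal by (rule table_cell(1)[where j = ?j and q = ?p and v = ?a]; simp add: simps holds_input_upd less_imp_le j v; fail)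
    apply (rule runs_Assign_val[where y = 0 and z = "int (index (Suc ?j, ?q, ?v))"]; (simp add: simps; fail)?)
    subgoal by (rule table_cell(2)[where j = "Suc ?j" and q = ?q and v = ?v]; simp add: simps holds_input_upd Suc_leI j v; fail)
    subgoal by (rule table_cell(1)[where j = "Suc ?j" and q = ?q and v = ?v]; simp add: simps holds_input_upd Suc_leI j v; fail)
    subgoal using m by (simp add: located_def search_inv_def holds_input_upd table_upd_other)
    done
qed

text \<open>The two nested tests together decide \<open>improves r\<close>, so the branches
  correspond to \<open>searched_improve\<close> and \<open>searched_keep\<close>.\<close>

lemma runs_relax_com:
  assumes r: "r < k * nt * (n + 1)" and m: "located r m"
  shows "runs relax_com (csize relax_com) (\<lambda>m'. holds_input m' \<and> m' ''r'' 0 = int r \<and> m' ''l'' 0 = 0 \<and>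
     searched k (Suc r) (table m' ''next'') (table m' ''best'')) m"
    (is "runs _ _ ?R m")
proof -
  let ?v = "vertex_of r" and ?e = "edge_of r" and ?j = "layer_of r"
  let ?q = "src ?e" and ?a = "lab ?e" and ?p = "tgt ?e"
  let ?x = "(?j, ?p, ?a)" and ?y = "(Suc ?j, ?q, ?v)"
  let ?nx = "table m ''next''" and ?bs = "table m ''best''"
  let ?c = "(int ?v - 1) * int n + (int ?a - 1)"
  have e: "?e < nt" and j: "?j < k" and v: "?v \<le> n"
    using r edge_of_less layer_of_less vertex_of_le by blast+
  note ed = edge[OF e]
  have h: "holds_input m" "m ''r'' 0 = int r" "m ''l'' 0 = 0" "m ''e'' 0 = int ?e" "m ''c'' 0 = ?c"
      "m ''x'' 0 = int (index ?x)" "m ''y'' 0 = int (index ?y)"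
    and s: "searched k r ?nx ?bs"
    using m by (auto simp: located_def search_inv_def)
  have adj: "m ''adjacency'' ?c = (if arc ?v ?a then 1 else 0)"
    and wt: "arc ?v ?a \<Longrightarrow> m ''weight'' ?c = wt ?v ?a"
    using h(1) v ed by (auto simp: holds_input_def)
  have cells: "?x \<in> cells" "?y \<in> cells" using ed v by (auto simp: cells_def)
  then have tab: "m ''next'' (int (index ?x)) = ?nx ?x" "m ''next'' (int (index ?y)) = ?nx ?y"
    "m ''best'' (int (index ?x)) = ?bs ?x" "m ''best'' (int (index ?y)) = ?bs ?y"
    by (auto simp: table_def)
  have bx: "0 \<le> ?nx ?x \<and> ?nx ?x \<le> int nt + 1 \<and> \<bar>?bs ?x\<bar> \<le> int ?j * W"
    using ed j by (intro searched_bounds[OF s less_imp_le[OF r] W]) auto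
  have "by": "0 \<le> ?nx ?y \<and> ?nx ?y \<le> int nt + 1 \<and> \<bar>?bs ?y\<bar> \<le> int (Suc ?j) * W"
    using ed j v by (intro searched_bounds[OF s less_imp_le[OF r] W]) auto
  \<comment> \<open>The candidate weight belongs to layer \<open>layer_of r + 1\<close>, which is at
    most \<open>k\<close>; hence it fits below \<open>k * W\<close>.\<close>
  have jW: "int (Suc ?j) * W \<le> B"
  proof -
    have "int (Suc ?j) * W \<le> int k * W" using j W by (intro mult_right_mono) auto
    then show ?thesis using B_weight by linarith
  qed
  have jW': "int (Suc ?j) * W = int ?j * W + W" by (simp add: algebra_simps)
  have wd: "\<bar>wt ?v ?a\<bar> \<le> W" if "arc ?v ?a" using wt_le[OF that] .
  have wB: "\<bar>wt ?v ?a\<bar> \<le> B" "\<bar>wt ?v ?a + ?bs ?x\<bar> \<le> B" if "arc ?v ?a"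
    using wd[OF that] bx jW jW' W by (auto simp: abs_le_iff)
  have xB: "\<bar>?nx ?x\<bar> \<le> B" "\<bar>?nx ?y\<bar> \<le> B" "\<bar>?bs ?x\<bar> \<le> B" "\<bar>?bs ?y\<bar> \<le> B" "\<bar>?nx ?x\<bar> \<le> A"
    using bx "by" jW jW' W A_edge A_le_B by auto
  have idx: "int (index ?x) \<le> A" "int (index ?y) \<le> A"
    using index_less[of ?j ?p ?a] index_less[of "Suc ?j" ?q ?v] ed v j A_table by linarith+
  have B: "0 \<le> B" "1 \<le> B" "2 \<le> B" "1 \<le> A" "\<bar>?c\<bar> \<le> B" "int ?e + 1 \<le> B" "int ?e \<le> B"
      "int (index ?x) \<le> B" "int (index ?y) \<le> B"
    using A_bounds A_edge A_le_B e matrix_index(2)[OF v, of ?a] ed idx by linarith+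
  show ?thesis unfolding relax_com_def
  proof (rule runs_If_csize)
    show "fits A B (Bin Mul (Read ''adjacency'' (scl ''c'')) (Read ''next'' (scl ''x''))) m"
      using xB B by (simp add: h adj tab)
    assume "aval (Bin Mul (Read ''adjacency'' (scl ''c'')) (Read ''next'' (scl ''x''))) m \<noteq> 0"
    then have arc: "arc ?v ?a" and nz: "?nx ?x \<noteq> 0"
      by (auto simp: h adj tab split: if_splits)
    let ?d = "wt ?v ?a + ?bs ?x"
    let ?m = "m(''d'' := (m ''d'')(0 := ?d))"
    have t: "table ?m ''next'' = ?nx" "table ?m ''best'' = ?bs" by (simp_all add: table_upd_other)
    show "runs (Seq (Assign ''d'' (Const 0) (Bin Add (Read ''weight'' (scl ''c'')) (Read ''best'' (scl ''x''))))
            (com.If (Bin Add (Bin Eq (Read ''next'' (scl ''y'')) (Const 0))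
                         (Bin Lt (scl ''d'') (Read ''best'' (scl ''y''))))
               (Seq (Assign ''next'' (scl ''y'') (Bin Add (scl ''e'') (Const 1)))
                    (Assign ''best'' (scl ''y'') (scl ''d'')))
               Skip))
       (csize (Seq (Assign ''d'' (Const 0) (Bin Add (Read ''weight'' (scl ''c'')) (Read ''best'' (scl ''x''))))
            (com.If (Bin Add (Bin Eq (Read ''next'' (scl ''y'')) (Const 0))
                         (Bin Lt (scl ''d'') (Read ''best'' (scl ''y''))))
               (Seq (Assign ''next'' (scl ''y'') (Bin Add (scl ''e'') (Const 1)))
                    (Assign ''best'' (scl ''y'') (scl ''d'')))
               Skip))) ?R m"
    proof (rule runs_Assign_Seq[where y = 0 and z = ?d])
      show "runs (com.If (Bin Add (Bin Eq (Read ''next'' (scl ''y'')) (Const 0))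
                         (Bin Lt (scl ''d'') (Read ''best'' (scl ''y''))))
               (Seq (Assign ''next'' (scl ''y'') (Bin Add (scl ''e'') (Const 1)))
                    (Assign ''best'' (scl ''y'') (scl ''d'')))
               Skip)
          (csize (com.If (Bin Add (Bin Eq (Read ''next'' (scl ''y'')) (Const 0))
                         (Bin Lt (scl ''d'') (Read ''best'' (scl ''y''))))
               (Seq (Assign ''next'' (scl ''y'') (Bin Add (scl ''e'') (Const 1)))
                    (Assign ''best'' (scl ''y'') (scl ''d'')))
               Skip)) ?R ?m"
      proof (rule runs_If_csize)
        show "fits A B (Bin Add (Bin Eq (Read ''next'' (scl ''y'')) (Const 0))
                         (Bin Lt (scl ''d'') (Read ''best'' (scl ''y'')))) ?m"
          using xB B wB[OF arc] by (simp add: h tab)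
        assume "aval (Bin Add (Bin Eq (Read ''next'' (scl ''y'')) (Const 0))
                         (Bin Lt (scl ''d'') (Read ''best'' (scl ''y'')))) ?m \<noteq> 0"
        then have imp: "improves r ?nx ?bs"
          using arc nz by (auto simp: improves_def h tab split: if_splits)
        show "runs (Seq (Assign ''next'' (scl ''y'') (Bin Add (scl ''e'') (Const 1)))
                    (Assign ''best'' (scl ''y'') (scl ''d'')))
           (csize (Seq (Assign ''next'' (scl ''y'') (Bin Add (scl ''e'') (Const 1)))
                    (Assign ''best'' (scl ''y'') (scl ''d'')))) ?R ?m"
          apply (rule runs_Assign_Seq[where y = "int (index ?y)" and z = "int ?e + 1"];
              (use B in \<open>simp add: h; fail\<close>)?)
          apply (rule runs_Assign_val[where y = "int (index ?y)" and z = ?d];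
              (use B wB[OF arc] in \<open>simp add: h; fail\<close>)?)
          apply (intro conjI)
          subgoal using h by (simp add: holds_input_upd)
          subgoal using h by simp
          subgoal using h by simp
          subgoal using searched_improve[OF s r imp]
            by (simp add: t table_upd[OF cells(2)] table_upd_other del: fun_upd_apply)
          done
      next
        assume "aval (Bin Add (Bin Eq (Read ''next'' (scl ''y'')) (Const 0))
                         (Bin Lt (scl ''d'') (Read ''best'' (scl ''y'')))) ?m = 0"
        then have "\<not> improves r ?nx ?bs" by (auto simp: improves_def h tab split: if_splits)
        then show "runs Skip (csize Skip) ?R ?m"
          using searched_keep[OF s] h t by (intro runs_Skip) (simp add: holds_input_upd)
      qed
    qed (use wB[OF arc] B xB in \<open>simp_all add: h tab wt[OF arc]\<close>)
  next
    assume "aval (Bin Mul (Read ''adjacency'' (scl ''c'')) (Read ''next'' (scl ''x''))) m = 0"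
    then have "\<not> improves r ?nx ?bs" by (auto simp: improves_def h adj tab split: if_splits)
    then show "runs Skip (csize Skip) ?R m"
      using searched_keep[OF s] h by (intro runs_Skip) simp
  qed
qed

lemma runs_search_body:
  assumes r: "r < k * nt * (n + 1)" and m: "search_inv r m"
  shows "runs search_body (csize search_body) (search_inv (Suc r)) m"
proof -
  have B: "0 \<le> B" "1 \<le> B" "int r + 1 \<le> B" "int r \<le> B"
    using r A_steps A_bounds A_le_B by linarith+
  show ?thesis unfolding search_body_def
    apply (rule runs_Seq_csize[OF runs_locate_com[OF r m]])
    apply (rule runs_Seq_csize[OF runs_relax_com[OF r]], assumption)
    apply (rule runs_Assign_val[where y = 0 and z = "int (Suc r)"])
    using B by (simp_all add: search_inv_def holds_input_upd table_upd_other)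
qed

lemma runs_search_com:
  assumes "search_inv 0 m"
  shows "runs search_com (k * nt * (n + 1) * 2000 + 200) (search_inv (k * nt * (n + 1))) m"
proof -
  let ?e = "Bin Lt (scl ''r'') (Bin Mul (Bin Mul (scl ''k'') (scl ''Pnum_transitions'')) (Bin Add (scl ''n'') (Const 1)))"
  let ?L = "k * nt * (n + 1)"
  have "k * nt * 1 \<le> ?L" by (intro mult_le_mono) auto
  then have "int (k * nt) \<le> int ?L" by (simp only: of_nat_le_iff mult_1_right)
  then have X: "int (k * nt) \<le> A" "int (k * nt) \<le> B" "int ?L \<le> A" "int ?L \<le> B" using A_steps A_le_B by linarith+
  have L: "int k * int nt = int (k * nt)" "int (k * nt) * (int n + 1) = int ?L" by (simp_all only: of_nat_mult of_nat_add of_nat_1)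
  have e: "fits A B ?e m \<and> aval ?e m = (if r < ?L then 1 else 0)" if "search_inv r m" "r \<le> ?L" for r m
  proof -
    have "m ''r'' 0 = int r" "m ''k'' 0 = int k" "m ''Pnum_transitions'' 0 = int nt" "m ''n'' 0 = int n"
      using that by (auto simp: search_inv_def holds_input_def)
    moreover have "int r \<le> B" using that(2) X by linarith
    ultimately show ?thesis using X A_bounds A_edge A_le_B
      by (simp add: L del: of_nat_mult of_nat_add)
  qed
  have "runs search_com (?L * (esize ?e + csize search_body) + esize ?e) (search_inv ?L) m"
    unfolding search_com_def
    using assms e by (intro runs_While[where I = search_inv]) (simp_all add: runs_search_body del: aval.simps fits.simps)
  \<comment> \<open>With the definitions unfolded the sizes are numerals: 2000 exceeds guard plus
    body, and 200 exceeds the last guard.\<close>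
  then show ?thesis
    by (rule runs_mono) (simp_all add: search_body_def locate_com_def relax_com_def table_cell_def)
qed

section \<open>Reading off an optimal path\<close>

definition extract_inv :: "(nat \<times> nat \<times> nat \<Rightarrow> int) \<Rightarrow> nat \<Rightarrow> memory \<Rightarrow> bool" where
  "extract_inv nx i m \<longleftrightarrow> holds_input m \<and> m ''l'' 0 = int i \<and> m ''found'' 0 = 1 \<and> table m ''next'' = nx \<and>
     (\<exists>q<N. \<exists>v\<le>n. m ''q'' 0 = int q \<and> m ''v'' 0 = int v \<and> nx (k - i, q, v) \<noteq> 0 \<and>
        trace nx (k - i) q v = drop i (trace nx k start 0)) \<and>
     (\<forall>i'<i. m ''path'' (int i') = int (trace nx k start 0 ! i'))"

text \<open>What remains to be output is the trace from the current state and vertex, a suffix of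
  the full trace; one pass emits its head.\<close>

lemma runs_extract_body:
  assumes s: "searched k (k * nt * (n + 1)) nx bs" and i: "i < k" and m: "extract_inv nx i m"
    and len: "length (trace nx k start 0) = k"
  shows "runs extract_body (csize extract_body) (extract_inv nx (Suc i)) m"
proof -
  let ?x = "trace nx k start 0"
  have h: "holds_input m" "m ''l'' 0 = int i" "m ''found'' 0 = 1" "table m ''next'' = nx"
    and p: "\<And>i'. i' < i \<Longrightarrow> m ''path'' (int i') = int (?x ! i')"
    using m by (auto simp: extract_inv_def)
  obtain q v where qv: "q < N" "v \<le> n" "m ''q'' 0 = int q" "m ''v'' 0 = int v" "nx (k - i, q, v) \<noteq> 0"
      and tr: "trace nx (k - i) q v = drop i ?x"
    using m by (auto simp: extract_inv_def)
  have ki: "k - i = Suc (k - Suc i)" using i by simp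
  obtain e where e: "e < nt" "src e = q" "nx (k - i, q, v) = int e + 1" "arc v (lab e)"
      "nx (k - Suc i, tgt e, lab e) \<noteq> 0"
    using searched_edge[OF s, of "k - Suc i" q v] qv i by (auto simp: ki)
  note ed = edge[OF e(1)]
  have "drop i ?x = lab e # trace nx (k - Suc i) (tgt e) (lab e)"
    using tr e(3) unfolding ki by simp
  moreover have "drop i ?x = ?x ! i # drop (Suc i) ?x" using i len by (simp add: Cons_nth_drop_Suc)
  ultimately have x: "?x ! i = lab e" "trace nx (k - Suc i) (tgt e) (lab e) = drop (Suc i) ?x" by auto
  have mk: "m ''k'' 0 = int k" "m ''Plabel'' (int e) = int (lab e)" "m ''Ptarget'' (int e) = int (tgt e)"
    using h(1) e(1) by (auto simp: holds_input_def)
  have B: "0 \<le> B" "1 \<le> B" "int k \<le> B" "int i \<le> B" "int i + 1 \<le> B" "int q \<le> B" "int v \<le> B" "int e + 1 \<le> B" "int e \<le> B"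
      "int (lab e) \<le> B" "int (tgt e) \<le> B" "int k - int i \<le> B" "0 \<le> int k - int i"
    using A_bounds A_edge A_le_B e(1) qv(1,2) i ed by linarith+
  let ?c = "table_cell (Bin Sub (scl ''k'') (scl ''l'')) (scl ''q'') (scl ''v'')"
  have "int k - int i = int (k - i)" using i by simp
  then have c: "aval ?c m = int (index (k - i, q, v))" "fits A B ?c m"
    using table_cell[OF h(1), of "Bin Sub (scl ''k'') (scl ''l'')" "scl ''q''" "scl ''v''" "k - i" q v] qv mk h B
    by simp_all
  have nz: "m ''next'' (int (index (k - i, q, v))) = int e + 1"
    using e(3) qv(1,2) h(4) by (auto simp: table_def cells_def)
  have new: "\<And>i'. i' < Suc i \<Longrightarrow> (if i' = i then int (lab e) else m ''path'' (int i')) = int (?x ! i')"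
    using p x by auto
  show ?thesis unfolding extract_body_def
    apply (rule runs_Assign_Seq[where y = 0 and z = "int e"]; (use B c nz in \<open>simp; fail\<close>)?)
    apply (rule runs_Assign_Seq[where y = 0 and z = "int (lab e)"]; (use B mk in \<open>simp; fail\<close>)?)
    apply (rule runs_Assign_Seq[where y = "int i" and z = "int (lab e)"]; (use B h in \<open>simp; fail\<close>)?)
    apply (rule runs_Assign_Seq[where y = 0 and z = "int (tgt e)"]; (use B mk in \<open>simp; fail\<close>)?)
    apply (rule runs_Assign_val[where y = 0 and z = "int (Suc i)"]; (use B h in \<open>simp; fail\<close>)?)
    using h e(5) ed x(2) new
    by (auto simp: extract_inv_def holds_input_upd table_upd_other)
qed

text \<open>The cell \<open>(k, start, 0)\<close> decides existence, by soundness in one direction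
  and optimality in the other; if it is non-zero, its trace is a minimal completion.\<close>

lemma runs_extract_com:
  assumes "search_inv (k * nt * (n + 1)) m"
  shows "runs extract_com (k * 500 + 500) (\<lambda>m. if \<exists>x. completes k start 0 x
      then m ''found'' 0 = 1 \<and> (\<exists>x. completes k start 0 x \<and>
        (\<forall>y. completes k start 0 y \<longrightarrow> weight 0 x \<le> weight 0 y) \<and> (\<forall>i<k. m ''path'' (int i) = int (x ! i)))
      else m ''found'' 0 = 0) m"
    (is "runs _ _ ?R m")
proof -
  let ?nx = "table m ''next''" and ?bs = "table m ''best''"
  let ?z = "(k, start, 0)"
  have h: "holds_input m" "m ''l'' 0 = 0" and s: "searched k (k * nt * (n + 1)) ?nx ?bs"
    using assms by (auto simp: search_inv_def)
  have mk: "m ''k'' 0 = int k" "m ''Pstart'' 0 = int start" using h(1) by (auto simp: holds_input_def)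
  have ex: "(\<exists>x. completes k start 0 x) \<longleftrightarrow> ?nx ?z \<noteq> 0"
    using searched_optimal[OF s, of k start 0] trace_completes[OF s, of k start 0] start by auto
  have best: "completes k start 0 (trace ?nx k start 0)"
    "\<And>y. completes k start 0 y \<Longrightarrow> weight 0 (trace ?nx k start 0) \<le> weight 0 y" if "?nx ?z \<noteq> 0"
    using searched_optimal[OF s, of k start 0] trace_completes[OF s, of k start 0] start that by auto
  have bz: "0 \<le> ?nx ?z \<and> ?nx ?z \<le> int nt + 1"
    using searched_bounds[OF s order_refl W, of k start 0] start by simp
  have B: "0 \<le> B" "1 \<le> B" "int k \<le> B" "int start \<le> B" "?nx ?z \<le> B"
    using A_bounds A_edge A_le_B start bz by linarith+
  let ?c = "table_cell (scl ''k'') (scl ''Pstart'') (Const 0)"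
  have c: "aval ?c m = int (index ?z)" "fits A B ?c m"
    using table_cell[OF h(1), of "scl ''k''" "scl ''Pstart''" "Const 0" k start 0] mk B start
    by simp_all
  have nz: "m ''next'' (int (index ?z)) = ?nx ?z" using start by (auto simp: table_def cells_def)
  let ?f = "if ?nx ?z \<noteq> 0 then 1 else 0 :: int"
  let ?e = "Bin Lt (scl ''l'') (scl ''k'')"
  let ?m1 = "m(''found'' := (m ''found'')(0 := ?f))"
  let ?m2 = "?m1(''q'' := (?m1 ''q'')(0 := int start))"
  let ?m3 = "?m2(''v'' := (?m2 ''v'')(0 := 0))"
  let ?N = "k * (esize ?e + csize extract_body) + esize ?e + 1"
  have 3: "runs (com.If (scl ''found'') (While ?e extract_body) Skip) (esize (scl ''found'') + ?N) ?R ?m3"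
  proof (rule runs_If)
    show "fits A B (scl ''found'') ?m3" using B by simp
    assume "aval (scl ''found'') ?m3 \<noteq> 0"
    then have f: "?nx ?z \<noteq> 0" by (auto split: if_splits)
    have inv: "extract_inv ?nx 0 ?m3"
      using h start f by (auto simp: extract_inv_def holds_input_upd table_upd_other)
    have e: "fits A B ?e m \<and> aval ?e m = (if i < k then 1 else 0)" if "extract_inv ?nx i m" "i \<le> k" for i m
    proof -
      have "m ''l'' 0 = int i" "m ''k'' 0 = int k" using that(1) by (auto simp: extract_inv_def holds_input_def)
      moreover have "int i \<le> B" using that(2) B by linarith
      ultimately show ?thesis using B by simp
    qed
    have len: "length (trace ?nx k start 0) = k" using best(1)[OF f] by (simp add: completes_def)
    have "runs (While ?e extract_body) (k * (esize ?e + csize extract_body) + esize ?e) (extract_inv ?nx k) ?m3"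
      using inv e by (intro runs_While[where I = "extract_inv ?nx"])
        (simp_all add: runs_extract_body[OF s _ _ len] del: aval.simps fits.simps fun_upd_apply)
    then show "runs (While ?e extract_body) ?N ?R ?m3"
    proof (rule runs_mono)
      fix m' assume "extract_inv ?nx k m'"
      then show "?R m'" using best[OF f] f ex by (auto simp: extract_inv_def)
    qed simp
  next
    assume "aval (scl ''found'') ?m3 = 0"
    then have f: "?nx ?z = 0" by (auto split: if_splits)
    have "runs Skip (csize Skip) ?R ?m3" by (rule runs_Skip) (use f ex in simp)
    then show "runs Skip ?N ?R ?m3" by (rule runs_mono) simp_all
  qed
  have "runs extract_com (csize (Assign ''found'' (Const 0) (Bin Lt (Const 0) (Read ''next'' ?c))) +
      (csize (Assign ''q'' (Const 0) (scl ''Pstart'')) + (csize (Assign ''v'' (Const 0) (Const 0)) +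
        (esize (scl ''found'') + ?N)))) ?R m"
    unfolding extract_com_def
    apply (rule runs_Seq[OF runs_Assign_val[where R = "\<lambda>m'. m' = ?m1" and y = 0 and z = ?f]];
        (use c nz bz B in \<open>simp; fail\<close>)?)
    apply (rule runs_Seq[OF runs_Assign_val[where R = "\<lambda>m'. m' = ?m2" and y = 0 and z = "int start"]];
        (use mk B in \<open>simp; fail\<close>)?)
    apply (rule runs_Seq[OF runs_Assign_val[where R = "\<lambda>m'. m' = ?m3" and y = 0 and z = 0]];
        (use B in \<open>simp; fail\<close>)?)
    using 3 by blast
  then show ?thesis by (rule runs_mono) (simp_all add: extract_body_def table_cell_def)
qed

lemma runs_solve_com:
  assumes "holds_input m" "m ''i'' 0 = 0" "m ''r'' 0 = 0" "m ''l'' 0 = 0"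
    "m ''next'' = (\<lambda>_. 0)" "m ''best'' = (\<lambda>_. 0)"
  shows "runs solve_com (300 * N + 2000 * (k * nt * (n + 1)) + 500 * k + 1000) (\<lambda>m. if \<exists>x. completes k start 0 x
      then m ''found'' 0 = 1 \<and> (\<exists>x. completes k start 0 x \<and>
        (\<forall>y. completes k start 0 y \<longrightarrow> weight 0 x \<le> weight 0 y) \<and> (\<forall>i<k. m ''path'' (int i) = int (x ! i)))
      else m ''found'' 0 = 0) m"
    (is "runs _ _ ?R m")
proof -
  have "nil_inv 0 m" using assms by (auto simp: nil_inv_def table_def fun_eq_iff)
  moreover have "search_inv 0 m" if "nil_inv N m" for m
    using that by (auto simp: nil_inv_def search_inv_def nil_layer_def intro!: searched_start)
  ultimately have "runs solve_com ((300 * N + 300) + ((k * nt * (n + 1) * 2000 + 200) + (k * 500 + 500))) ?R m"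
    unfolding solve_com_def
    by (intro runs_Seq[OF runs_nil_com] runs_Seq[OF runs_search_com] runs_extract_com)
  then show ?thesis by (rule runs_mono) simp_all
qed

end

section \<open>From the automaton to minimum weight paths\<close>

lemma labels_path_letters:
  "labels_path D p x q \<Longrightarrow> set x \<subseteq> {a. \<exists>p q. (p, a, q) \<in> D}"
  by (induction x arbitrary: p) auto

lemma distinct_word_through_letter:
  assumes "1 \<le> k" "k \<le> n" "a \<in> {1..n}"
  obtains x where "x \<in> distinct_words k n" "a \<in> set x"
proof -
  obtain Y where Y: "{a} \<subseteq> Y" "Y \<subseteq> {1..n}" "card Y = k"
    using exists_subset_between[of "{a}" k "{1..n}"] assms by auto
  obtain x where "set x = Y" "distinct x"
    using finite_distinct_list[of Y] Y(2) finite_subset by blast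
  then show thesis using that[of x] Y distinct_card[of x] by (auto simp: distinct_words_def)
qed

text \<open>For \<open>k \<ge> 1\<close> every letter occurs in some accepted word and hence labels
  a transition. This puts \<open>n\<close> and \<open>k\<close> below the size of \<open>M\<close>,
  so that they fit into a word.\<close>

lemma letters_le_card_transitions:
  assumes "nfa_over {1..n} M" "nfa_lang M = distinct_words k n" "1 \<le> k" "k \<le> n"
  shows "n \<le> card (transitions M)"
proof -
  have "{1..n} \<subseteq> (\<lambda>(p, a, q). a) ` transitions M"
  proof
    fix a assume "a \<in> {1..n}"
    then obtain x where "x \<in> nfa_lang M" "a \<in> set x"
      using distinct_word_through_letter[OF assms(3,4)] assms(2) by metis
    then obtain p q where "(p, a, q) \<in> transitions M"
      using labels_path_letters by (fastforce simp: nfa_lang_def)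
    then show "a \<in> (\<lambda>(p, a, q). a) ` transitions M" by force
  qed
  moreover have "finite (transitions M)" using assms(1) by (simp add: nfa_over_def)
  ultimately show ?thesis using surj_card_le[of "transitions M" "{1..n}"] by simp
qed

text \<open>The \<open>d\<close> extra bits are generously counted as \<open>d\<close> words, which
  keeps the bound independent of \<open>b\<close>.\<close>

lemma words_le:
  assumes "1 \<le> b" "\<bar>x\<bar> < 2 ^ (c * b + d)"
  shows "words b x \<le> 1 + c + d"
proof -
  have "bitlen \<bar>x\<bar> \<le> int (c * b + d)" using assms(2)
    by (subst bitlen_le_iff_power) (simp del: of_nat_add of_nat_mult)
  then have "nat (bitlen \<bar>x\<bar>) \<le> c * b + d" by (simp only: nat_le_iff)
  then have "nat (bitlen \<bar>x\<bar>) div b \<le> (c * b + d) div b" by (rule div_le_mono)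
  also have "\<dots> = c + d div b" using assms(1) by simp
  also have "\<dots> \<le> c + d" by simp
  finally show ?thesis by (simp add: words_def)
qed

text \<open>The cube appears because table addresses and step numbers have three factors of size at
  most \<open>S\<close>. The bounds are \<open>words_le\<close> with \<open>c = 3\<close>, where
  \<open>d\<close> is 1 for addresses and the bit length of \<open>W\<close> for weights.\<close>

lemma word_bounds_cube:
  assumes b: "1 \<le> b" and S: "S \<le> 2 ^ b" and W: "1 \<le> W"
  shows "word_bounds b (4 + nat (bitlen W)) (int (S * S * S)) (int (S * S * S) * W)"
proof
  have "S * S * S \<le> 2 ^ b * 2 ^ b * 2 ^ b" using S by (intro mult_le_mono)
  also have "\<dots> = 2 ^ (3 * b)" by (simp add: power_add[symmetric] mult_2 numeral_3_eq_3)
  finally have "int (S * S * S) \<le> int (2 ^ (3 * b))" by (simp only: of_nat_le_iff)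
  then have A: "int (S * S * S) \<le> 2 ^ (3 * b)" by simp
  show "words b x \<le> 5" if "\<bar>x\<bar> \<le> int (S * S * S)" for x
  proof -
    have "\<bar>x\<bar> < 2 ^ (3 * b + 1)" using that A zero_less_power[of "2::int" "3 * b"]
      unfolding power_add power_one_right by linarith
    from words_le[OF b this] show ?thesis by simp
  qed
  show "words b x \<le> 4 + nat (bitlen W)" if "\<bar>x\<bar> \<le> int (S * S * S) * W" for x
  proof -
    have "int (S * S * S) * W \<le> 2 ^ (3 * b) * W" using A W by (intro mult_right_mono) auto
    also have "\<dots> < 2 ^ (3 * b) * 2 ^ nat (bitlen W)" using bitlen_bounds[of W] W by simp
    finally have "\<bar>x\<bar> < 2 ^ (3 * b + nat (bitlen W))" using that by (simp add: power_add)
    from words_le[OF b this] show ?thesis by simp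
  qed
qed simp

lemma matrix_entry:
  assumes "1 \<le> v" "v \<le> n" "1 \<le> a" "a \<le> n"
  shows "matrix n f ((int v - 1) * int n + (int a - 1)) = f (v, a)"
proof -
  obtain v' a' where va: "v = Suc v'" "a = Suc a'" using assms by (cases v; cases a) auto
  then have le: "v' + 1 \<le> n" "a' < n" using assms by auto
  have i: "(int v - 1) * int n + (int a - 1) = int (v' * n + a')" by (simp add: va)
  have "(v' + 1) * n \<le> n * n" using le by (intro mult_right_mono) auto
  then have "v' * n + a' < n * n" using le by simp
  then have "int (v' * n + a') < int (n * n)" by (simp only: of_nat_less_iff)
  moreover have "(v' * n + a') div n = v'" "(v' * n + a') mod n = a'" using le by simp_all
  ultimately show ?thesis unfolding i matrix_def by (simp add: va del: of_nat_mult of_nat_add)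
qed

lemma matrix_negative: "i < 0 \<Longrightarrow> matrix n f i = 0"
  by (simp add: matrix_def)

text \<open>\<open>P\<close> must not see the graph, which is stored in arrays that \<open>P\<close> may use as well, hence the
  renaming.  The last assignment before the search adds a virtual vertex 0 with the single arc
  \<open>(0, s)\<close>: the row of vertex 0 lies at the negative indices of the adjacency matrix, and the
  weights there are 0.\<close>

definition path_program :: "com \<Rightarrow> com" where
  "path_program P =
     Seq (Assign ''Pk'' (Const 0) (scl ''k''))
    (Seq (Assign ''Pn'' (Const 0) (scl ''n''))
    (Seq (rename_com ((#) (CHR ''P'')) P)
    (Seq (Assign ''adjacency'' (Bin Sub (Bin Sub (scl ''s'') (Const 1)) (scl ''n'')) (Const 1))
         solve_com)))"

definition virtual_arc :: "nat pair_pre_digraph \<Rightarrow> nat \<Rightarrow> nat \<Rightarrow> nat \<Rightarrow> bool" where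
  "virtual_arc G s v a \<longleftrightarrow> (if v = 0 then a = s else (v, a) \<in> parcs G)"

definition virtual_weight :: "(nat \<times> nat \<Rightarrow> int) \<Rightarrow> nat \<Rightarrow> nat \<Rightarrow> int" where
  "virtual_weight w v a = (if v = 0 then 0 else w (v, a))"

locale path_instance =
  fixes b k n :: nat and M :: "(nat, nat) nfa" and W :: int and G :: "nat pair_pre_digraph"
    and w :: "nat \<times> nat \<Rightarrow> int" and s t :: nat and ts :: "(nat \<times> nat \<times> nat) list"
  assumes k: "1 \<le> k" "k \<le> n" and two_le_W: "2 \<le> W"
    and over: "nfa_over {1..n} M" and lang: "nfa_lang M = distinct_words k n"
    and size: "nfa_size M \<le> 2 ^ b"
    and states: "states M = {..<card (states M)}"
    and ts: "distinct ts" "set ts = transitions M"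
    and G: "pair_wf_digraph G" "pverts G = {1..n}" and st: "s \<in> {1..n}" "t \<in> {1..n}"
    and weight_range: "\<And>e. e \<in> parcs G \<Longrightarrow> w e \<in> {-W..W}"
begin

abbreviation "src e \<equiv> fst (ts ! e)"
abbreviation "lab e \<equiv> fst (snd (ts ! e))"
abbreviation "tgt e \<equiv> snd (snd (ts ! e))"
abbreviation "N \<equiv> card (states M)"
abbreviation "S \<equiv> nfa_size M"

lemma length_ts: "length ts = card (transitions M)"
  using ts distinct_card by metis

lemma sizes: "N + length ts = S" "1 \<le> N" "n \<le> length ts" "1 \<le> b" "start M < N"
proof -
  show 1: "N + length ts = S" by (simp add: nfa_size_def length_ts)
  have "start M \<in> states M" using over by (simp add: nfa_over_def)
  then show 2: "start M < N" using states by auto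
  then show 3: "1 \<le> N" by simp
  show 4: "n \<le> length ts" using letters_le_card_transitions[OF over lang k] length_ts by simp
  \<comment> \<open>A word of 0 bits would only allow \<open>S \<le> 1\<close>.\<close>
  have "2 \<le> S" using 1 3 4 k by simp
  then show "1 \<le> b" using size by (cases b) auto
qed

sublocale search_program n N src lab tgt "length ts" "accepting M" t
  "virtual_arc G s" "virtual_weight w" W b "4 + nat (bitlen W)"
  "int (S * S * S)" "int (S * S * S) * W" k "start M"
proof -
  interpret word_bounds b "4 + nat (bitlen W)" "int (S * S * S)" "int (S * S * S) * W"
    using word_bounds_cube[of b S W] sizes size two_le_W by simp
  \<comment> \<open>At least \<open>n\<close> transitions and one state give
    \<open>n + 1 \<le> S\<close>; then \<open>k \<le> n\<close> gives
    \<open>k + 1 \<le> S\<close>.\<close>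
  have S: "k + 1 \<le> S" "n + 1 \<le> S" "N \<le> S" "length ts \<le> S" "n \<le> S" "k \<le> S" "1 \<le> S" "length ts + 1 \<le> S"
    using sizes k by linarith+
  show "search_program n N src lab tgt (length ts) t
      (virtual_arc G s) (virtual_weight w) W b (4 + nat (bitlen W))
      (int (S * S * S)) (int (S * S * S) * W) k (start M)"
  proof
    fix e assume "e < length ts"
    then have "ts ! e \<in> transitions M" using ts nth_mem by metis
    then have "ts ! e \<in> states M \<times> {1..n} \<times> states M" using over by (auto simp: nfa_over_def)
    then show "src e < N \<and> tgt e < N \<and> 1 \<le> lab e \<and> lab e \<le> n"
      using states by (auto simp: mem_Times_iff)
  next
    fix v a assume "virtual_arc G s v a"
    then show "\<bar>virtual_weight w v a\<bar> \<le> W"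
      using weight_range[of "(v, a)"] two_le_W by (auto simp: virtual_arc_def virtual_weight_def)
  next
    show "start M < N" "t \<le> n" "0 \<le> W" using sizes st two_le_W by auto
    have "(k + 1) * N * (n + 1) \<le> S * S * S" using S by (intro mult_le_mono) auto
    then show "int ((k + 1) * N * (n + 1)) \<le> int (S * S * S)" by (simp only: of_nat_le_iff)
    have "k * length ts * (n + 1) \<le> S * S * S" using S by (intro mult_le_mono) auto
    then show "int (k * length ts * (n + 1)) \<le> int (S * S * S)" by (simp only: of_nat_le_iff)
    have "1 * n * n \<le> S * S * S" using S by (intro mult_le_mono) auto
    then show "int (n * n) \<le> int (S * S * S)" by (simp only: of_nat_le_iff mult_1_left)
    have "1 * 1 * (length ts + 1) \<le> S * S * S" using S by (intro mult_le_mono) auto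
    then have "int (length ts + 1) \<le> int (S * S * S)" by (simp only: of_nat_le_iff mult_1_left)
    then show "int (length ts) + 1 \<le> int (S * S * S)" by simp
    have "1 * 1 * k \<le> S * S * S" using S by (intro mult_le_mono) auto
    then have "int k \<le> int (S * S * S)" by (simp only: of_nat_le_iff mult_1_left)
    then show "int k * W \<le> int (S * S * S) * W" using two_le_W by (intro mult_right_mono) auto
    show "int (S * S * S) \<le> int (S * S * S) * W" using two_le_W mult_left_mono[of 1 W "int (S * S * S)"] by simp
  qed
qed

section \<open>Completions from vertex 0 as simple paths\<close>

lemma edges_transitions: "edges = transitions M"
proof -
  have "edges = (\<lambda>e. ts ! e) ` {..<length ts}" unfolding edges_def by (simp add: prod_eq_iff)
  also have "\<dots> = set ts" by (auto simp: set_conv_nth)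
  finally show ?thesis using ts by simp
qed

lemma walk_vwalk:
  assumes "0 \<notin> set (v # x)"
  shows "walk v x \<longleftrightarrow> set (vwalk_arcs (v # x)) \<subseteq> parcs G \<and> last (v # x) = t"
    and "weight v x = sum_list (map w (vwalk_arcs (v # x)))"
  using assms by (induction x arbitrary: v) (auto simp: virtual_arc_def virtual_weight_def)

text \<open>Distinctness, length and alphabet come from \<open>nfa_lang M\<close>. The walk from
  vertex 0 contributes the first vertex \<open>s\<close>, by its only arc, then the arcs of
  \<open>G\<close> and the end \<open>t\<close>.\<close>

lemma completes_simple_path: "completes k (start M) 0 x \<longleftrightarrow> simple_st_k_path G s t k x"
proof (cases x)
  case Nil
  then show ?thesis using k by (simp add: completes_def simple_st_k_path_def)
next
  case (Cons a y)
  have "completes k (start M) 0 x \<longleftrightarrow> x \<in> distinct_words k n \<and> walk 0 x"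
    unfolding completes_def edges_transitions lang[symmetric]
    using lang by (auto simp: nfa_lang_def distinct_words_def)
  also have "\<dots> \<longleftrightarrow> x \<in> distinct_words k n \<and> a = s \<and> set (vwalk_arcs x) \<subseteq> parcs G \<and> last x = t"
  proof (cases "x \<in> distinct_words k n")
    case True
    then have "0 \<notin> set (a # y)" by (auto simp: distinct_words_def Cons)
    from walk_vwalk(1)[OF this] show ?thesis using True by (auto simp: Cons virtual_arc_def)
  qed simp
  also have "\<dots> \<longleftrightarrow> simple_st_k_path G s t k x"
    by (auto simp: simple_st_k_path_def vpath_def vwalk_def distinct_words_def G Cons)
  finally show ?thesis .
qed

text \<open>The virtual arc weighs 0, and no later arc leaves vertex 0, which is not a vertex of
  \<open>G\<close>.\<close>

lemma weight_path_weight: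
  assumes "completes k (start M) 0 x"
  shows "real_of_int (weight 0 x) = path_weight (\<lambda>e. real_of_int (w e)) x"
proof -
  have "simple_st_k_path G s t k x" using assms completes_simple_path by simp
  then have "set x \<subseteq> {1..n}" "x \<noteq> []"
    by (auto simp: simple_st_k_path_def vpath_def vwalk_def G)
  then obtain a y where x: "x = a # y" "0 \<notin> set x" by (cases x) force+
  then have "weight 0 x = sum_list (map w (vwalk_arcs x))"
    using walk_vwalk(2)[of a y] by (simp add: virtual_weight_def)
  moreover have "real_of_int (sum_list (map w l)) = sum_list (map (\<lambda>e. real_of_int (w e)) l)" for l
    by (induction l) auto
  ultimately show ?thesis by (simp add: path_weight_def)
qed

lemma correct_path_outputI:
  assumes "if \<exists>x. completes k (start M) 0 x
      then m ''found'' 0 = 1 \<and> (\<exists>x. completes k (start M) 0 x \<and>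
        (\<forall>y. completes k (start M) 0 y \<longrightarrow> weight 0 x \<le> weight 0 y) \<and> (\<forall>i<k. m ''path'' (int i) = int (x ! i)))
      else m ''found'' 0 = 0"
  shows "correct_path_output G (\<lambda>e. real_of_int (w e)) s t k m"
proof (cases "\<exists>x. completes k (start M) 0 x")
  case False
  then show ?thesis using assms by (simp add: correct_path_output_def completes_simple_path)
next
  case True
  then obtain x where x: "completes k (start M) 0 x" "m ''found'' 0 = 1"
    "\<And>y. completes k (start M) 0 y \<Longrightarrow> weight 0 x \<le> weight 0 y" "\<forall>i<k. m ''path'' (int i) = int (x ! i)"
    using assms by auto
  have "path_weight (\<lambda>e. real_of_int (w e)) x \<le> path_weight (\<lambda>e. real_of_int (w e)) y"
    if "simple_st_k_path G s t k y" for y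
    using x(1) x(3)[of y] that weight_path_weight[of x] weight_path_weight[of y]
    by (simp add: completes_simple_path flip: of_int_le_iff[where 'a = real])
  then have "min_wt_simple_st_k_path G (\<lambda>e. real_of_int (w e)) s t k x"
    using x(1) by (simp add: min_wt_simple_st_k_path_def completes_simple_path)
  then show ?thesis using x by (auto simp: correct_path_output_def completes_simple_path)
qed

text \<open>The run of \<open>P\<close> keeps its time \<open>T\<close>, and everything else is
  counted in words of the weight bound. The constant 1200 covers 1000 from the search, 6 for each
  copied parameter and 100 for the virtual arc.\<close>

lemma path_program_time:
  assumes "exec b P (nfa_input k n) T m" "holds_nfa m M" 
    and enum: "m ''num_transitions'' 0 = int (length ts)"
      "\<forall>i < length ts. case ts ! i of (p, a, q) \<Rightarrow> m ''source'' (int i) = int p \<and>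
           m ''label'' (int i) = int a \<and> m ''target'' (int i) = int q"
  shows "\<exists>T' m'. exec b (path_program P) (path_input k n G w s t) T' m' \<and>
    correct_path_output G (\<lambda>e. real_of_int (w e)) s t k m' \<and>
    T' \<le> T + (4 + nat (bitlen W)) * (300 * N + 2000 * (k * length ts * (n + 1)) + 500 * k + 1200)"
proof -
  let ?A = "int (S * S * S)" and ?B = "int (S * S * S) * W"
  let ?f = "(#) (CHR ''P'')"
  let ?m0 = "path_input k n G w s t"
  let ?m1 = "?m0(''Pk'' := (?m0 ''Pk'')(0 := int k))"
  let ?m2 = "?m1(''Pn'' := (?m1 ''Pn'')(0 := int n))"
  have inj: "inj ?f" by (simp add: inj_def)
  have B: "0 \<le> ?B" "1 \<le> ?B" "int k \<le> ?B" "int n \<le> ?B" "int s \<le> ?B" "\<bar>int s - 1\<bar> \<le> ?B" "\<bar>int s - 1 - int n\<bar> \<le> ?B"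
    using A_bounds A_le_B st by auto
  have m0: "?m0 ''k'' 0 = int k" "?m0 ''n'' 0 = int n" by (simp_all add: path_input_def scalar_def)
  have "runs (Assign ''Pk'' (Const 0) (scl ''k'')) (csize (Assign ''Pk'' (Const 0) (scl ''k''))) (\<lambda>m. m = ?m1) ?m0"
    by (rule runs_Assign_val[where y = 0 and z = "int k"]) (use B m0 in simp_all)
  then obtain T1 where T1: "exec b (Assign ''Pk'' (Const 0) (scl ''k'')) ?m0 T1 ?m1" "T1 \<le> (4 + nat (bitlen W)) * 6"
    by (auto simp: runs_def)
  have "runs (Assign ''Pn'' (Const 0) (scl ''n'')) (csize (Assign ''Pn'' (Const 0) (scl ''n''))) (\<lambda>m. m = ?m2) ?m1"
    by (rule runs_Assign_val[where y = 0 and z = "int n"]) (use B m0 in simp_all)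
  then obtain T2 where T2: "exec b (Assign ''Pn'' (Const 0) (scl ''n'')) ?m1 T2 ?m2" "T2 \<le> (4 + nat (bitlen W)) * 6"
    by (auto simp: runs_def)
  \<comment> \<open>All other prefixed arrays are still 0, so \<open>P\<close> starts on precisely
    its own input.\<close>
  have "?m2 \<circ> ?f = nfa_input k n"
    by (auto simp: fun_eq_iff path_input_def nfa_input_def scalar_def)
  then obtain m3 where m3: "exec b (rename_com ?f P) ?m2 T m3" "m3 \<circ> ?f = m" "\<forall>y. y \<notin> range ?f \<longrightarrow> m3 y = ?m2 y"
    using exec_rename_com[OF assms(1) inj] by blast
  have P: "m3 (CHR ''P'' # x) = m x" for x using m3(2) by auto
  have in3: "m3 x = ?m0 x" if "hd x \<noteq> CHR ''P''" for x
  proof -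
    have "x \<notin> range ?f" "x \<noteq> ''Pk''" "x \<noteq> ''Pn''" using that by auto
    then show ?thesis using m3(3) by simp
  qed
  \<comment> \<open>The address \<open>(0 - 1) * n + (s - 1)\<close> of the arc
    \<open>(0, s)\<close>; being negative, it lies outside the input matrix.\<close>
  let ?i = "int s - 1 - int n"
  let ?m4 = "m3(''adjacency'' := (m3 ''adjacency'')(?i := 1))"
  let ?c4 = "Assign ''adjacency'' (Bin Sub (Bin Sub (scl ''s'') (Const 1)) (scl ''n'')) (Const 1)"
  have "m3 ''s'' 0 = int s" "m3 ''n'' 0 = int n" by (simp_all add: in3 path_input_def scalar_def)
  then have "runs ?c4 (csize ?c4) (\<lambda>m. m = ?m4) m3"
    by (intro runs_Assign_val[where y = ?i and z = 1]) (use B in simp_all)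
  then obtain T4 where T4: "exec b ?c4 m3 T4 ?m4" "T4 \<le> (4 + nat (bitlen W)) * 100"
    by (force simp: runs_def)
  have holds: "holds_input ?m4"
  proof -
    have adj: "?m4 ''adjacency'' ((int v - 1) * int n + (int a - 1)) = (if virtual_arc G s v a then 1 else 0)"
      and wt: "virtual_arc G s v a \<longrightarrow> ?m4 ''weight'' ((int v - 1) * int n + (int a - 1)) = virtual_weight w v a"
      if "v \<le> n" "1 \<le> a" "a \<le> n" for v a
    proof -
      let ?j = "(int v - 1) * int n + (int a - 1)"
      have a0: "m3 ''adjacency'' = matrix n (\<lambda>e. if e \<in> parcs G then 1 else 0)"
        and w0: "m3 ''weight'' = matrix n (\<lambda>e. if e \<in> parcs G then w e else 0)"
        by (simp_all add: in3 path_input_def)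
      show "?m4 ''adjacency'' ?j = (if virtual_arc G s v a then 1 else 0)"
      proof (cases "v = 0")
        case True
        then show ?thesis using that matrix_negative[of ?j n] by (auto simp: a0 virtual_arc_def)
      next
        case False
        then have "0 \<le> (int v - 1) * int n" by simp
        then have "?j \<noteq> ?i" using st that by auto
        then show ?thesis using matrix_entry[of v n a] that False by (simp add: a0 virtual_arc_def)
      qed
      show "virtual_arc G s v a \<longrightarrow> ?m4 ''weight'' ?j = virtual_weight w v a"
      proof (cases "v = 0")
        case True
        then show ?thesis using that matrix_negative[of ?j n] by (auto simp: w0 virtual_weight_def)
      next
        case False
        then show ?thesis using matrix_entry[of v n a] that by (simp add: w0 virtual_arc_def virtual_weight_def)
      qed
    qed
    have kn: "?m4 ''k'' 0 = int k" "?m4 ''n'' 0 = int n" "?m4 ''t'' 0 = int t"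
      by (simp_all add: in3 path_input_def scalar_def)
    have "q < N \<Longrightarrow> q \<in> states M" for q using states by auto
    then have "?m4 ''Pnum_states'' 0 = int N" "?m4 ''Pstart'' 0 = int (start M)"
        "\<forall>q<N. ?m4 ''Paccepting'' (int q) = (if q \<in> accepting M then 1 else 0)"
      using assms(2) by (simp_all add: P holds_nfa_def)
    moreover have "?m4 ''Pnum_transitions'' 0 = int (length ts)"
        "\<forall>e<length ts. ?m4 ''Psource'' (int e) = int (src e) \<and> ?m4 ''Plabel'' (int e) = int (lab e) \<and>
           ?m4 ''Ptarget'' (int e) = int (tgt e)"
      using enum by (simp_all add: P case_prod_unfold)
    ultimately show ?thesis using kn adj wt unfolding holds_input_def by blast
  qed
  have z: "?m4 ''i'' 0 = 0" "?m4 ''r'' 0 = 0" "?m4 ''l'' 0 = 0" "?m4 ''next'' = (\<lambda>_. 0)" "?m4 ''best'' = (\<lambda>_. 0)"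
    by (simp_all add: in3 path_input_def)
  obtain T5 m5 where T5: "exec b solve_com ?m4 T5 m5"
      "T5 \<le> (4 + nat (bitlen W)) * (300 * N + 2000 * (k * length ts * (n + 1)) + 500 * k + 1000)"
      "correct_path_output G (\<lambda>e. real_of_int (w e)) s t k m5"
    using runs_solve_com[OF holds z] correct_path_outputI unfolding runs_def by blast
  have "exec b (path_program P) ?m0 (T1 + (T2 + (T + (T4 + T5)))) m5"
    unfolding path_program_def
    by (rule exec.Seq[OF T1(1) exec.Seq[OF T2(1) exec.Seq[OF m3(1) exec.Seq[OF T4(1) T5(1)]]]])
  moreover have "T1 + (T2 + (T + (T4 + T5)))
      \<le> T + (4 + nat (bitlen W)) * (300 * N + 2000 * (k * length ts * (n + 1)) + 500 * k + 1200)"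
    using T1(2) T2(2) T4(2) T5(2) unfolding distrib_left by linarith
  ultimately show ?thesis using T5(3) by blast
qed

text \<open>As \<open>W \<ge> 2\<close>, \<open>4 + bitlen W\<close> is at most
  \<open>5 + log 2 W\<close> and so at most \<open>6 * log 2 W\<close>. With
  \<open>X = S * n * n\<close> the operations number at most
  \<open>(300 + 4000 + 500 + 1200) * X\<close>, and 6 * 6000 is below 40000.\<close>

lemma time_bound:
  "real ((4 + nat (bitlen W)) * (300 * N + 2000 * (k * length ts * (n + 1)) + 500 * k + 1200))
    \<le> 40000 * real S * real n ^ 2 * log 2 (real_of_int W)"
proof -
  have L: "1 \<le> log 2 (real_of_int W)" using two_le_W by (simp add: le_log_iff)
  have "real (nat (bitlen W)) \<le> log 2 (real_of_int W) + 1"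
    using two_le_W L by (simp add: bitlen_alt_def of_nat_nat)
  then have K: "real (4 + nat (bitlen W)) \<le> 6 * log 2 (real_of_int W)" using L by simp
  have n: "1 \<le> n" and S: "1 \<le> S" using k sizes by linarith+
  define X where "X = S * (n * n)"
  have "N * (1 * 1) \<le> X" unfolding X_def using sizes n by (intro mult_le_mono) auto
  moreover have "1 * (k * 1) \<le> X" unfolding X_def using k n S by (intro mult_le_mono) auto
  moreover have "1 * (1 * 1) \<le> X" unfolding X_def using n S by (intro mult_le_mono) auto
  moreover have "k * length ts * (n + 1) \<le> n * S * (2 * n)" using k n sizes by (intro mult_le_mono) auto
  then have "k * length ts * (n + 1) \<le> 2 * X" by (simp add: X_def mult_ac)
  ultimately have "300 * N + 2000 * (k * length ts * (n + 1)) + 500 * k + 1200 \<le> 6000 * X" by linarith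
  then have "real (300 * N + 2000 * (k * length ts * (n + 1)) + 500 * k + 1200) \<le> real (6000 * X)"
    by (simp only: of_nat_le_iff)
  with K have "real (4 + nat (bitlen W)) * real (300 * N + 2000 * (k * length ts * (n + 1)) + 500 * k + 1200)
      \<le> (6 * log 2 (real_of_int W)) * real (6000 * X)"
    using L by (intro mult_mono) auto
  also have "\<dots> \<le> 40000 * real S * real n ^ 2 * log 2 (real_of_int W)"
    using L by (simp add: X_def power2_eq_square)
  finally show ?thesis by (simp only: of_nat_mult)
qed

end

lemma path_program_solves:
  assumes "1 \<le> k" "k \<le> n" "2 \<le> W" and fast: "fast_distinct_words_nfa C P b k n M"
  shows "solves_min_wt_path b (path_program P) k n {-W..W}
    ((\<bar>C\<bar> + 40000) * real (nfa_size M) * real n ^ 2 * log 2 (real_of_int W))"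
  unfolding solves_min_wt_path_def
proof (intro allI impI, elim conjE)
  fix G w s t
  assume inst: "pair_wf_digraph G" "pverts G = {1..n}" "s \<in> {1..n}" "t \<in> {1..n}"
    "\<forall>e \<in> parcs G. w e \<in> {-W..W}"
  have M: "nfa_over {1..n} M" "nfa_lang M = distinct_words k n" "nfa_size M \<le> 2 ^ b"
    using fast by (simp_all add: fast_distinct_words_nfa_def)
  obtain T m where T: "exec b P (nfa_input k n) T m" "holds_nfa m M" "real T \<le> C * real (nfa_size M)"
    using fast unfolding fast_distinct_words_nfa_def constructs_nfa_def by blast
  obtain ts where enum: "distinct ts" "set ts = transitions M" "m ''num_transitions'' 0 = int (length ts)"
      "\<forall>i < length ts. case ts ! i of (p, a, q) \<Rightarrow> m ''source'' (int i) = int p \<and>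
           m ''label'' (int i) = int a \<and> m ''target'' (int i) = int q"
    using T(2) unfolding holds_nfa_def by blast
  have states: "states M = {..<card (states M)}" using T(2) by (simp add: holds_nfa_def)
  interpret path_instance b k n M W G w s t ts
    by (rule path_instance.intro) (use assms(1-3) M enum(1,2) inst states in auto)
  obtain T' m' where T': "exec b (path_program P) (path_input k n G w s t) T' m'"
    "correct_path_output G (\<lambda>e. real_of_int (w e)) s t k m'"
    "T' \<le> T + (4 + nat (bitlen W)) * (300 * N + 2000 * (k * length ts * (n + 1)) + 500 * k + 1200)"
    using path_program_time[OF T(1,2) enum(3,4)] by blast
  have "1 \<le> log 2 (real_of_int W)" using assms(3) by (simp add: le_log_iff)
  moreover have "1 \<le> real n ^ 2" using assms(1,2) by (intro one_le_power) simp
  \<comment> \<open>This factor of at least 1 absorbs the time of \<open>P\<close> into the common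
    bound.\<close>
  ultimately have 1: "1 * 1 \<le> real n ^ 2 * log 2 (real_of_int W)" by (intro mult_mono) auto
  have "real T \<le> \<bar>C\<bar> * real S" using T(3) using mult_right_mono[OF abs_ge_self, of "real S" C] by simp
  also have "\<dots> \<le> \<bar>C\<bar> * real S * (real n ^ 2 * log 2 (real_of_int W))"
    using mult_left_mono[OF 1, of "\<bar>C\<bar> * real S"] by simp
  finally have "real T' \<le> \<bar>C\<bar> * real S * (real n ^ 2 * log 2 (real_of_int W)) +
      40000 * real S * real n ^ 2 * log 2 (real_of_int W)"
    using T'(3) time_bound by linarith
  also have "\<dots> = (\<bar>C\<bar> + 40000) * real S * real n ^ 2 * log 2 (real_of_int W)"
    by (simp add: algebra_simps)
  finally show "\<exists>T m. exec b (path_program P) (path_input k n G w s t) T m \<and>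
      correct_path_output G (\<lambda>e. real_of_int (w e)) s t k m \<and>
      real T \<le> (\<bar>C\<bar> + 40000) * real S * real n ^ 2 * log 2 (real_of_int W)"
    using T' by blast
qed

lemma solves_min_wt_path_mono:
  assumes "solves_min_wt_path b Q k n R c" "R' \<subseteq> R" "c \<le> c'"
  shows "solves_min_wt_path b Q k n R' c'"
  unfolding solves_min_wt_path_def
proof (intro allI impI, elim conjE)
  fix G w s t
  assume "pair_wf_digraph G" "pverts G = {1..n}" "s \<in> {1..n}" "t \<in> {1..n}" "\<forall>e \<in> parcs G. w e \<in> R'"
  then obtain T m where "exec b Q (path_input k n G w s t) T m"
    "correct_path_output G (\<lambda>e. real_of_int (w e)) s t k m" "real T \<le> c"
    using assms(1,2) unfolding solves_min_wt_path_def by blast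
  then show "\<exists>T m. exec b Q (path_input k n G w s t) T m \<and>
      correct_path_output G (\<lambda>e. real_of_int (w e)) s t k m \<and> real T \<le> c'"
    using assms(3) by (meson order_trans)
qed

text \<open>There is a start state and at least one transition; the bound makes \<open>log 2\<close>
  of the size at least 1.\<close>

lemma two_le_nfa_size:
  assumes "1 \<le> k" "k \<le> n" "fast_distinct_words_nfa C P b k n M"
  shows "2 \<le> nfa_size M"
proof -
  have M: "nfa_over {1..n} M" "nfa_lang M = distinct_words k n"
    using assms by (simp_all add: fast_distinct_words_nfa_def)
  then have "n \<le> card (transitions M)" using letters_le_card_transitions assms by blast
  moreover have "card (states M) \<noteq> 0" using M(1) by (auto simp: nfa_over_def)
  ultimately show ?thesis using assms(1,2) by (simp add: nfa_size_def)
qed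

theorem theorem1p2:
  fixes C :: real
  shows "\<exists>C'. \<forall>P.
    (\<exists>Q. \<forall>b k n M W. 1 \<le> k \<and> k \<le> n \<and> 2 \<le> W \<and> fast_distinct_words_nfa C P b k n M \<longrightarrow>
       solves_min_wt_path b Q k n {0..W}
         (C' * real (nfa_size M) * log 2 (real (nfa_size M)) * real n ^ 2 * log 2 (real_of_int W))) \<and>
    (\<exists>Q. \<forall>b k n M W. 1 \<le> k \<and> k \<le> n \<and> 2 \<le> W \<and> fast_distinct_words_nfa C P b k n M \<and>
         acyclic_nfa M \<longrightarrow>
       solves_min_wt_path b Q k n {-W..W}
         (C' * real (nfa_size M) * real n ^ 2 * log 2 (real_of_int W)))"
proof (intro exI[of _ "\<bar>C\<bar> + 40000"] allI conjI)
  fix P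
  let ?C = "\<bar>C\<bar> + 40000"
  show "\<exists>Q. \<forall>b k n M W. 1 \<le> k \<and> k \<le> n \<and> 2 \<le> W \<and> fast_distinct_words_nfa C P b k n M \<longrightarrow>
       solves_min_wt_path b Q k n {0..W}
         (?C * real (nfa_size M) * log 2 (real (nfa_size M)) * real n ^ 2 * log 2 (real_of_int W))"
  proof (intro exI[of _ "path_program P"] allI impI, elim conjE)
    fix b k n M and W :: int
    assume a: "1 \<le> k" "k \<le> n" "2 \<le> W" "fast_distinct_words_nfa C P b k n M"
    have "1 \<le> log 2 (real (nfa_size M))" using two_le_nfa_size[OF a(1,2,4)] by (simp add: le_log_iff)
    \<comment> \<open>With both logarithms bounded below, inserting \<open>log 2\<close> of the size
      can only enlarge the time bound.\<close>
    moreover have "0 \<le> log 2 (real_of_int W)" using a(3) by simp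
    ultimately have "?C * real (nfa_size M) * real n ^ 2 * log 2 (real_of_int W) * 1
        \<le> ?C * real (nfa_size M) * real n ^ 2 * log 2 (real_of_int W) * log 2 (real (nfa_size M))"
      by (intro mult_left_mono) auto
    then show "solves_min_wt_path b (path_program P) k n {0..W}
         (?C * real (nfa_size M) * log 2 (real (nfa_size M)) * real n ^ 2 * log 2 (real_of_int W))"
      using a(3) by (intro solves_min_wt_path_mono[OF path_program_solves[OF a]]) (auto simp: mult_ac)
  qed
  show "\<exists>Q. \<forall>b k n M W. 1 \<le> k \<and> k \<le> n \<and> 2 \<le> W \<and> fast_distinct_words_nfa C P b k n M \<and>
         acyclic_nfa M \<longrightarrow>
       solves_min_wt_path b Q k n {-W..W}
         (?C * real (nfa_size M) * real n ^ 2 * log 2 (real_of_int W))"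
    using path_program_solves by blast
qed

end
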